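(* Let $G$ be an amenable group and let $A,B\subset G$ be subsets with $\sigma^R(A)>0$ and $\sigma^R(B)>0$. Then the set $AA^{-1}BB^{-1}$ is a neighborhood of the unit $1_G$ in the Bohr topology of $G$.
   Context: A group $G$ is amenable if it admits a left-invariant finitely additive probability measure defined on all subsets of $G$. For $A\subset G$, $\sigma^R(A)=\inf_{F}\sup_{y\in G}\frac{|F\cap Ay|}{|F|}$, where $F$ runs over all non-empty finite subsets of $G$. The Bohr topology on a group $G$ is the smallest topology on $G$ for which the canonical homomorphism $\eta:G\to bG$ is continuous, where $(bG,\eta)$ is the Bohr compactification of $G$: $bG$ is a compact Hausdorff topological group and $\eta:G\to bG$ is a homomorphism such that every homomorphism $f:G\to K$ to a compact Hausdorff topological group factors as $f=\bar f\circ\eta$ for a unique continuous homomorphism $\bar f:bG\to K$. Here $AA^{-1}BB^{-1}=\{a_1a_2^{-1}b_1b_2^{-1}:a_1,a_2\in A,\ b_1,b_2\in B\}$. *)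

theory Defs
  imports "HOL-Analysis.Analysis" "HOL-Algebra.Product_Groups"
begin

section \<open>Amenable groups and the upper density\<close>

definition amenable_group :: "('a, 'm) monoid_scheme \<Rightarrow> bool" where
  "amenable_group G \<longleftrightarrow> Group.group G \<and>
     (\<exists>\<mu> :: 'a set \<Rightarrow> real.
        (\<forall>A. A \<subseteq> carrier G \<longrightarrow> 0 \<le> \<mu> A) \<and>
        \<mu> (carrier G) = 1 \<and>
        (\<forall>A B. A \<subseteq> carrier G \<longrightarrow> B \<subseteq> carrier G \<longrightarrow> A \<inter> B = {} \<longrightarrow> \<mu> (A \<union> B) = \<mu> A + \<mu> B) \<and>
        (\<forall>g A. g \<in> carrier G \<longrightarrow> A \<subseteq> carrier G \<longrightarrow> \<mu> (g <#\<^bsub>G\<^esub> A) = \<mu> A))"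

text \<open>The quotients lie between 0 and 1 and both index sets are nonempty, so the
  real-valued infimum and supremum are the genuine ones.\<close>

definition sigma_R :: "('a, 'm) monoid_scheme \<Rightarrow> 'a set \<Rightarrow> real" where
  "sigma_R G A = (INF F \<in> {F. finite F \<and> F \<noteq> {} \<and> F \<subseteq> carrier G}.
                    SUP y \<in> carrier G. real (card (F \<inter> (A #>\<^bsub>G\<^esub> y))) / real (card F))"

section \<open>The Bohr compactification and the Bohr topology\<close>

definition topological_group :: "('a, 'm) monoid_scheme \<Rightarrow> 'a topology \<Rightarrow> bool" where
  "topological_group K T \<longleftrightarrow> Group.group K \<and> topspace T = carrier K \<and>
     continuous_map (prod_topology T T) T (\<lambda>(x, y). x \<otimes>\<^bsub>K\<^esub> y) \<and>
     continuous_map T T (\<lambda>x. inv\<^bsub>K\<^esub> x)"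

definition compact_Hausdorff_group :: "('a, 'm) monoid_scheme \<Rightarrow> 'a topology \<Rightarrow> bool" where
  "compact_Hausdorff_group K T \<longleftrightarrow> topological_group K T \<and> compact_space T \<and> Hausdorff_space T"

definition continuous_homs ::
    "('a, 'm) monoid_scheme \<Rightarrow> 'a topology \<Rightarrow> ('b, 'n) monoid_scheme \<Rightarrow> 'b topology \<Rightarrow> ('a \<Rightarrow> 'b) set" where
  "continuous_homs H T K U = {g \<in> hom H K \<inter> extensional (carrier H). continuous_map T U g}"

text \<open>A HOL definition cannot quantify over all types, so the test groups \<open>K\<close> of the universal
  property live on one type, the sum of \<open>'a set set\<close> (large enough for a copy of the closure of the
  image of any homomorphism from \<open>G\<close> to a compact Hausdorff group) and the type of \<open>bG\<close> itself.
  This loses nothing: \<open>bohr_compactification_universal\<close> below derives the universal property for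
  compact Hausdorff groups on arbitrary types, and \<open>bohr_compactification_exists\<close> shows that
  every group has a Bohr compactification. Here \<open>G\<close> carries no topology, so all homomorphisms
  out of \<open>G\<close> are considered.\<close>

definition bohr_compactification ::
    "('a, 'm) monoid_scheme \<Rightarrow> ('b, 'n) monoid_scheme \<Rightarrow> 'b topology \<Rightarrow> ('a \<Rightarrow> 'b) \<Rightarrow> bool" where
  "bohr_compactification G bG bT \<eta> \<longleftrightarrow>
     compact_Hausdorff_group bG bT \<and> \<eta> \<in> hom G bG \<and>
     (\<forall>(K :: ('a set set + 'b) monoid) T f.
        compact_Hausdorff_group K T \<longrightarrow> f \<in> hom G K \<longrightarrow>
        (\<exists>!g. g \<in> continuous_homs bG bT K T \<and> (\<forall>x\<in>carrier G. f x = g (\<eta> x))))"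

definition bohr_topology ::
    "('a, 'm) monoid_scheme \<Rightarrow> 'b topology \<Rightarrow> ('a \<Rightarrow> 'b) \<Rightarrow> 'a topology" where
  "bohr_topology G bT \<eta> = pullback_topology (carrier G) \<eta> bT"

lemma bohr_topology_smallest:
  assumes "bohr_compactification G bG bT \<eta>"
  shows "topspace (bohr_topology G bT \<eta>) = carrier G"
    and "continuous_map (bohr_topology G bT \<eta>) bT \<eta>"
    and "\<And>X U. topspace X = carrier G \<Longrightarrow> continuous_map X bT \<eta> \<Longrightarrow>
                openin (bohr_topology G bT \<eta>) U \<Longrightarrow> openin X U"
proof -
  have "\<eta> \<in> carrier G \<rightarrow> topspace bT"
    using assms by (auto simp: bohr_compactification_def compact_Hausdorff_group_def
        topological_group_def hom_def)
  then show "topspace (bohr_topology G bT \<eta>) = carrier G"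
    by (auto simp: bohr_topology_def topspace_pullback_topology)
  show "continuous_map (bohr_topology G bT \<eta>) bT \<eta>"
    using continuous_map_pullback[OF continuous_map_id, of "carrier G" \<eta> bT]
    by (simp add: bohr_topology_def)
  fix X U
  assume X: "topspace X = carrier G" "continuous_map X bT \<eta>" "openin (bohr_topology G bT \<eta>) U"
  then obtain V where V: "openin bT V" "U = \<eta> -` V \<inter> carrier G"
    by (auto simp: bohr_topology_def openin_pullback_topology)
  have "U = {x \<in> topspace X. \<eta> x \<in> V}" using V X by auto
  then show "openin X U" using X V by (simp add: continuous_map)
qed

subsection \<open>Closed subgroups, transport of structure\<close>

lemma compact_Hausdorff_groupD:
  assumes "compact_Hausdorff_group K T"
  shows "Group.group K" "topspace T = carrier K"
    "continuous_map (prod_topology T T) T (\<lambda>(x, y). x \<otimes>\<^bsub>K\<^esub> y)"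
    "continuous_map T T (\<lambda>x. inv\<^bsub>K\<^esub> x)" "compact_space T" "Hausdorff_space T"
  using assms by (auto simp: compact_Hausdorff_group_def topological_group_def)

lemma continuous_mult:
  assumes "compact_Hausdorff_group K T" "continuous_map X T a" "continuous_map X T b"
  shows "continuous_map X T (\<lambda>x. a x \<otimes>\<^bsub>K\<^esub> b x)"
proof -
  have "continuous_map X (prod_topology T T) (\<lambda>x. (a x, b x))"
    using assms by (simp add: continuous_map_paired)
  from continuous_map_compose[OF this compact_Hausdorff_groupD(3)[OF assms(1)]]
  show ?thesis by (simp add: o_def)
qed

lemma closure_subgroup:
  assumes K: "compact_Hausdorff_group K T" and S: "subgroup S K"
  shows "subgroup (T closure_of S) K"
proof -
  interpret K: Group.group K using compact_Hausdorff_groupD(1)[OF K] .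
  have ts: "topspace T = carrier K" using compact_Hausdorff_groupD(2)[OF K] .
  have sub: "S \<subseteq> T closure_of S"
    using subgroup.subset[OF S] by (simp add: closure_of_subset ts)
  have mult: "(\<lambda>(x, y). x \<otimes>\<^bsub>K\<^esub> y) ` ((T closure_of S) \<times> (T closure_of S)) \<subseteq> T closure_of S"
  proof -
    have "(\<lambda>(x, y). x \<otimes>\<^bsub>K\<^esub> y) ` (S \<times> S) \<subseteq> S"
      using subgroup.m_closed[OF S] by auto
    then have "T closure_of ((\<lambda>(x, y). x \<otimes>\<^bsub>K\<^esub> y) ` (S \<times> S)) \<subseteq> T closure_of S"
      by (rule closure_of_mono)
    moreover have "(\<lambda>(x, y). x \<otimes>\<^bsub>K\<^esub> y) ` (prod_topology T T closure_of (S \<times> S))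
        \<subseteq> T closure_of ((\<lambda>(x, y). x \<otimes>\<^bsub>K\<^esub> y) ` (S \<times> S))"
      using compact_Hausdorff_groupD(3)[OF K]
      by (rule continuous_map_image_closure_subset)
    ultimately show ?thesis by (simp add: closure_of_Times)
  qed
  have inv: "(\<lambda>x. inv\<^bsub>K\<^esub> x) ` (T closure_of S) \<subseteq> T closure_of S"
  proof -
    have "(\<lambda>x. inv\<^bsub>K\<^esub> x) ` S \<subseteq> S"
      using subgroup.m_inv_closed[OF S] by auto
    then have "T closure_of ((\<lambda>x. inv\<^bsub>K\<^esub> x) ` S) \<subseteq> T closure_of S"
      by (rule closure_of_mono)
    moreover have "(\<lambda>x. inv\<^bsub>K\<^esub> x) ` (T closure_of S) \<subseteq> T closure_of ((\<lambda>x. inv\<^bsub>K\<^esub> x) ` S)"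
      using compact_Hausdorff_groupD(4)[OF K]
      by (rule continuous_map_image_closure_subset)
    ultimately show ?thesis by blast
  qed
  show ?thesis
  proof (rule K.subgroupI)
    show "T closure_of S \<subseteq> carrier K" using closure_of_subset_topspace[of T S] ts by simp
    show "T closure_of S \<noteq> {}" using sub subgroup.one_closed[OF S] by auto
  qed (use mult inv in auto)
qed

lemma closed_subgroup:
  assumes K: "compact_Hausdorff_group K T" and S: "subgroup S K" and c: "closedin T S"
  shows "compact_Hausdorff_group (K\<lparr>carrier := S\<rparr>) (subtopology T S)"
proof -
  interpret K: Group.group K using compact_Hausdorff_groupD(1)[OF K] .
  have ts: "topspace T = carrier K" using compact_Hausdorff_groupD(2)[OF K] .
  have SK: "S \<subseteq> carrier K" using subgroup.subset[OF S] .
  have tsS: "topspace (subtopology T S) = S" using SK ts by auto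
  have id: "continuous_map (subtopology T S) T (\<lambda>x. x)"
    using continuous_map_from_subtopology[OF continuous_map_id] by (simp add: id_def)
  have "continuous_map (prod_topology (subtopology T S) (subtopology T S)) T (\<lambda>p. fst p \<otimes>\<^bsub>K\<^esub> snd p)"
    by (intro continuous_mult[OF K])
      (auto intro: continuous_map_compose[OF continuous_map_fst id, unfolded o_def]
        continuous_map_compose[OF continuous_map_snd id, unfolded o_def])
  then have m: "continuous_map (prod_topology (subtopology T S) (subtopology T S)) (subtopology T S)
       (\<lambda>(x, y). x \<otimes>\<^bsub>K\<^esub> y)"
    using subgroup.m_closed[OF S] SK ts
    by (auto simp: continuous_map_in_subtopology case_prod_unfold)
  have "continuous_map (subtopology T S) (subtopology T S) (\<lambda>x. inv\<^bsub>K\<^esub> x)"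
    using subgroup.m_inv_closed[OF S] SK ts
      continuous_map_from_subtopology[OF compact_Hausdorff_groupD(4)[OF K]]
    by (auto simp: continuous_map_in_subtopology)
  then have i: "continuous_map (subtopology T S) (subtopology T S) (\<lambda>x. inv\<^bsub>K\<lparr>carrier := S\<rparr>\<^esub> x)"
    by (rule continuous_map_eq) (simp add: tsS K.m_inv_consistent[OF S])
  show ?thesis
    unfolding compact_Hausdorff_group_def topological_group_def
    using m i tsS subgroup.subgroup_is_group[OF S K.is_group]
      closedin_compact_space[OF compact_Hausdorff_groupD(5)[OF K] c]
      Hausdorff_space_subtopology[OF compact_Hausdorff_groupD(6)[OF K], of S]
    by (auto simp: compact_space_subtopology)
qed

lemma transport:
  fixes K :: "('k, 'n) monoid_scheme" and j :: "'k \<Rightarrow> 'u"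
  assumes K: "compact_Hausdorff_group K T" and j: "inj_on j (carrier K)"
  obtains K' :: "'u monoid" and T' where
    "compact_Hausdorff_group K' T'" "carrier K' = j ` carrier K"
    "j \<in> hom K K'" "inv_into (carrier K) j \<in> hom K' K"
    "continuous_map T T' j" "continuous_map T' T (inv_into (carrier K) j)"
proof -
  interpret K: Group.group K using compact_Hausdorff_groupD(1)[OF K] .
  have ts: "topspace T = carrier K" using compact_Hausdorff_groupD(2)[OF K] .
  define i where "i = inv_into (carrier K) j"
  have ij: "i (j x) = x" if "x \<in> carrier K" for x
    using that j by (simp add: i_def)
  define K' :: "'u monoid" where
    "K' = \<lparr>carrier = j ` carrier K, mult = (\<lambda>p q. j (i p \<otimes>\<^bsub>K\<^esub> i q)), one = j \<one>\<^bsub>K\<^esub>\<rparr>"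
  have carK': "carrier K' = j ` carrier K" by (simp add: K'_def)
  define T' where "T' = pullback_topology (j ` carrier K) i T"
  have ts': "topspace T' = j ` carrier K"
    by (auto simp: T'_def topspace_pullback_topology ts ij)
  have G: "Group.group K'"
  proof (rule groupI)
    fix x assume "x \<in> carrier K'"
    then obtain a where a: "a \<in> carrier K" "x = j a" by (auto simp: K'_def)
    show "\<exists>y\<in>carrier K'. y \<otimes>\<^bsub>K'\<^esub> x = \<one>\<^bsub>K'\<^esub>"
      by (rule bexI[of _ "j (inv\<^bsub>K\<^esub> a)"]) (auto simp: K'_def a ij)
  qed (auto simp: K'_def ij K.m_assoc)
  have ji: "continuous_map T T' j"
    unfolding T'_def
    by (rule continuous_map_pullback')
      (auto simp: ts o_def ij intro: continuous_map_eq[OF continuous_map_id])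
  have ii: "continuous_map T' T i"
    using continuous_map_pullback[OF continuous_map_id, of "j ` carrier K" i T]
    by (simp add: T'_def)
  have jh: "j \<in> hom K K'" by (auto simp: hom_def K'_def ij)
  have ih: "i \<in> hom K' K" by (auto simp: hom_def K'_def ij)
  have "continuous_map (prod_topology T' T') T (\<lambda>p. i (fst p) \<otimes>\<^bsub>K\<^esub> i (snd p))"
    by (intro continuous_mult[OF K])
      (auto intro: continuous_map_compose[OF continuous_map_fst ii, unfolded o_def]
        continuous_map_compose[OF continuous_map_snd ii, unfolded o_def])
  from continuous_map_compose[OF this ji]
  have m: "continuous_map (prod_topology T' T') T' (\<lambda>(x, y). x \<otimes>\<^bsub>K'\<^esub> y)"
    by (simp add: o_def K'_def case_prod_unfold)
  have inv: "inv\<^bsub>K'\<^esub> x = j (inv\<^bsub>K\<^esub> (i x))" if "x \<in> carrier K'" for x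
    using that by (intro group.inv_equality[OF G]) (auto simp: K'_def ij)
  have "continuous_map T' T' (j \<circ> ((\<lambda>x. inv\<^bsub>K\<^esub> x) \<circ> i))"
    by (intro continuous_map_compose[OF _ ji] continuous_map_compose[OF ii]
        compact_Hausdorff_groupD(4)[OF K])
  then have n: "continuous_map T' T' (\<lambda>x. inv\<^bsub>K'\<^esub> x)"
    by (rule continuous_map_eq) (simp add: ts' inv o_def carK')
  have h: "T homeomorphic_space T'"
    unfolding homeomorphic_space_def homeomorphic_maps_def
    using ji ii by (intro exI[of _ j] exI[of _ i]) (auto simp: ts ts' ij)
  have "compact_Hausdorff_group K' T'"
    unfolding compact_Hausdorff_group_def topological_group_def
    using G m n ts' homeomorphic_compact_space[OF h] homeomorphic_Hausdorff_space[OF h]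
      compact_Hausdorff_groupD(5,6)[OF K]
    by (simp add: K'_def)
  then show ?thesis
    using that[of K' T'] jh ih ji ii by (simp add: i_def K'_def)
qed

text \<open>The closure of the image of a group injects into the double powerset of that group:
  send a point to the traces of its open neighbourhoods.\<close>

lemma closure_of_image_inj:
  fixes f :: "'a \<Rightarrow> 'k"
  assumes "Hausdorff_space T"
  shows "inj_on (\<lambda>x. {f -` U \<inter> S | U. openin T U \<and> x \<in> U}) (T closure_of (f ` S))"
proof (rule inj_onI, rule ccontr)
  fix x y
  assume x: "x \<in> T closure_of (f ` S)" and y: "y \<in> T closure_of (f ` S)"
    and eq: "{f -` U \<inter> S | U. openin T U \<and> x \<in> U} = {f -` U \<inter> S | U. openin T U \<and> y \<in> U}"
    and "x \<noteq> y"
  moreover have "x \<in> topspace T" "y \<in> topspace T" using x y by (auto simp: in_closure_of)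
  ultimately obtain U V where UV: "openin T U" "openin T V" "x \<in> U" "y \<in> V" "disjnt U V"
    using assms unfolding Hausdorff_space_def by metis
  then have "f -` U \<inter> S \<in> {f -` U \<inter> S | U. openin T U \<and> y \<in> U}"
    unfolding eq[symmetric] by blast
  then obtain W where W: "openin T W" "y \<in> W" "f -` U \<inter> S = f -` W \<inter> S" by blast
  have "openin T (V \<inter> W)" "y \<in> V \<inter> W" using UV W by auto
  with y obtain s where "s \<in> S" "f s \<in> V \<inter> W" unfolding in_closure_of by blast
  then show False using W UV by (auto simp: disjnt_def)
qed

lemma hom_image_subgroup:
  assumes "Group.group G" "Group.group K" "f \<in> hom G K"
  shows "subgroup (f ` carrier G) K"
  using group_hom.img_is_subgroup[of G K f] assms
  by (simp add: group_hom_def group_hom_axioms_def)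

lemma small_copy:
  fixes G :: "('a, 'm) monoid_scheme" and K :: "('k, 'n) monoid_scheme"
  assumes G: "Group.group G" and K: "compact_Hausdorff_group K T" and f: "f \<in> hom G K"
  obtains K' :: "'a set set monoid" and T' f' i where
    "compact_Hausdorff_group K' T'" "f' \<in> hom G K'"
    "i \<in> hom K' K" "continuous_map T' T i" "\<And>x. x \<in> carrier G \<Longrightarrow> i (f' x) = f x"
proof -
  define C where "C = T closure_of (f ` carrier G)"
  have KG: "Group.group K" using compact_Hausdorff_groupD(1)[OF K] .
  have sub: "subgroup C K"
    unfolding C_def by (intro closure_subgroup[OF K] hom_image_subgroup[OF G KG f])
  have CK: "C \<subseteq> carrier K" using subgroup.subset[OF sub] .
  have fC: "f ` carrier G \<subseteq> C"
    unfolding C_def using f compact_Hausdorff_groupD(2)[OF K]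
    by (intro closure_of_subset) (auto simp: hom_def)
  have KC: "compact_Hausdorff_group (K\<lparr>carrier := C\<rparr>) (subtopology T C)"
    by (rule closed_subgroup[OF K sub]) (simp add: C_def)
  define j :: "'k \<Rightarrow> 'a set set" where
    "j = (\<lambda>x. {f -` U \<inter> carrier G | U. openin T U \<and> x \<in> U})"
  have j: "inj_on j (carrier (K\<lparr>carrier := C\<rparr>))"
    unfolding j_def C_def using closure_of_image_inj[OF compact_Hausdorff_groupD(6)[OF K]] by simp
  obtain K' :: "'a set set monoid" and T' where
    *: "compact_Hausdorff_group K' T'" "carrier K' = j ` C"
    "j \<in> hom (K\<lparr>carrier := C\<rparr>) K'" "inv_into C j \<in> hom K' (K\<lparr>carrier := C\<rparr>)"
    "continuous_map (subtopology T C) T' j" "continuous_map T' (subtopology T C) (inv_into C j)"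
    using transport[OF KC j] by auto
  show ?thesis
  proof (rule that[OF *(1), of "j \<circ> f" "inv_into C j"])
    show "j \<circ> f \<in> hom G K'" using f fC *(3) by (simp add: hom_def Pi_iff image_subset_iff)
    show "inv_into C j \<in> hom K' K" using *(4) CK by (auto simp: hom_def)
    show "continuous_map T' T (inv_into C j)"
      using *(6) by (simp add: continuous_map_in_subtopology)
    show "inv_into C j ((j \<circ> f) x) = f x" if "x \<in> carrier G" for x
      using that fC j by (auto intro!: inv_into_f_f)
  qed
qed

subsection \<open>The universal property over all types\<close>

lemma universal_transport:
  fixes G :: "('a, 'm) monoid_scheme" and bG :: "('b, 'n) monoid_scheme"
    and K :: "('k, 'l) monoid_scheme" and j :: "'k \<Rightarrow> 'a set set + 'b"
  assumes b: "bohr_compactification G bG bT \<eta>"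
    and K: "compact_Hausdorff_group K T" and f: "f \<in> hom G K" and j: "inj_on j (carrier K)"
  shows "\<exists>!g. g \<in> continuous_homs bG bT K T \<and> (\<forall>x\<in>carrier G. f x = g (\<eta> x))"
proof -
  let ?i = "inv_into (carrier K) j"
  obtain K' :: "('a set set + 'b) monoid" and T' where
    *: "compact_Hausdorff_group K' T'" "carrier K' = j ` carrier K"
    "j \<in> hom K K'" "?i \<in> hom K' K" "continuous_map T T' j" "continuous_map T' T ?i"
    using transport[OF K j] by auto
  have \<eta>: "\<eta> \<in> hom G bG" using b by (simp add: bohr_compactification_def)
  have jf: "j \<circ> f \<in> hom G K'" using *(3) f by (simp add: hom_def Pi_iff)
  have E: "\<exists>!g. g \<in> continuous_homs bG bT K' T' \<and> (\<forall>x\<in>carrier G. (j \<circ> f) x = g (\<eta> x))"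
    using b *(1) jf unfolding bohr_compactification_def by blast
  then obtain g where g: "g \<in> continuous_homs bG bT K' T'" "\<forall>x\<in>carrier G. (j \<circ> f) x = g (\<eta> x)"
    by blast
  have tsb: "topspace bT = carrier bG"
    using b by (simp add: bohr_compactification_def compact_Hausdorff_group_def topological_group_def)
  show ?thesis
  proof (rule ex1I[of _ "restrict (?i \<circ> g) (carrier bG)"])
    have gh: "g \<in> hom bG K'" "continuous_map bT T' g" using g(1) by (auto simp: continuous_homs_def)
    have bgr: "Group.group bG"
      using b by (simp add: bohr_compactification_def compact_Hausdorff_group_def topological_group_def)
    have "?i \<circ> g \<in> hom bG K" using gh(1) *(4) by (simp add: hom_def Pi_iff)
    then have "restrict (?i \<circ> g) (carrier bG) \<in> hom bG K"
      using monoid.m_closed[OF group.is_monoid[OF bgr]] by (auto simp: hom_def)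
    moreover have "continuous_map bT T (restrict (?i \<circ> g) (carrier bG))"
      by (rule continuous_map_eq[OF continuous_map_compose[OF gh(2) *(6)]]) (simp add: tsb)
    moreover have "f x = restrict (?i \<circ> g) (carrier bG) (\<eta> x)" if x: "x \<in> carrier G" for x
    proof -
      have "\<eta> x \<in> carrier bG" "f x \<in> carrier K" using x \<eta> f by (auto simp: hom_def)
      moreover have "g (\<eta> x) = j (f x)" using g(2) x by simp
      ultimately show ?thesis using j by simp
    qed
    ultimately show "restrict (?i \<circ> g) (carrier bG) \<in> continuous_homs bG bT K T \<and>
        (\<forall>x\<in>carrier G. f x = restrict (?i \<circ> g) (carrier bG) (\<eta> x))"
      by (simp add: continuous_homs_def)
    fix h assume h: "h \<in> continuous_homs bG bT K T \<and> (\<forall>x\<in>carrier G. f x = h (\<eta> x))"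
    have hh: "h \<in> hom bG K" "continuous_map bT T h" "h \<in> extensional (carrier bG)"
      using h by (auto simp: continuous_homs_def)
    have "j \<circ> h \<in> hom bG K'" using hh(1) *(3) by (simp add: hom_def Pi_iff)
    then have "restrict (j \<circ> h) (carrier bG) \<in> hom bG K'"
      using monoid.m_closed[OF group.is_monoid[OF bgr]] by (auto simp: hom_def)
    moreover have "continuous_map bT T' (restrict (j \<circ> h) (carrier bG))"
      by (rule continuous_map_eq[OF continuous_map_compose[OF hh(2) *(5)]]) (simp add: tsb)
    moreover have "(j \<circ> f) x = restrict (j \<circ> h) (carrier bG) (\<eta> x)" if "x \<in> carrier G" for x
      using that \<eta> h by (auto simp: hom_def)
    ultimately have "restrict (j \<circ> h) (carrier bG) \<in> continuous_homs bG bT K' T' \<and>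
        (\<forall>x\<in>carrier G. (j \<circ> f) x = restrict (j \<circ> h) (carrier bG) (\<eta> x))"
      by (simp add: continuous_homs_def)
    with E g have eq: "restrict (j \<circ> h) (carrier bG) = g" by blast
    show "h = restrict (?i \<circ> g) (carrier bG)"
    proof (rule extensionalityI[OF hh(3)])
      fix z assume z: "z \<in> carrier bG"
      then have "h z \<in> carrier K" "g z = j (h z)" using hh(1) eq by (auto simp: hom_def)
      then show "h z = restrict (?i \<circ> g) (carrier bG) z" using j z by simp
    qed simp
  qed
qed

lemma bohr_compactification_dense:
  fixes G :: "('a, 'm) monoid_scheme" and bG :: "('b, 'n) monoid_scheme"
  assumes G: "Group.group G" and b: "bohr_compactification G bG bT \<eta>"
  shows "bT closure_of (\<eta> ` carrier G) = carrier bG"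
proof -
  have B: "compact_Hausdorff_group bG bT" and \<eta>: "\<eta> \<in> hom G bG"
    using b by (simp_all add: bohr_compactification_def)
  interpret B: Group.group bG using compact_Hausdorff_groupD(1)[OF B] .
  have tsb: "topspace bT = carrier bG" using compact_Hausdorff_groupD(2)[OF B] .
  define D where "D = bT closure_of (\<eta> ` carrier G)"
  have sub: "subgroup D bG"
    unfolding D_def by (intro closure_subgroup[OF B] hom_image_subgroup[OF G B.is_group \<eta>])
  have DB: "D \<subseteq> carrier bG" using subgroup.subset[OF sub] .
  have \<eta>D: "\<eta> ` carrier G \<subseteq> D"
    unfolding D_def using \<eta> tsb by (intro closure_of_subset) (auto simp: hom_def)
  have BD: "compact_Hausdorff_group (bG\<lparr>carrier := D\<rparr>) (subtopology bT D)"
    by (rule closed_subgroup[OF B sub]) (simp add: D_def)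
  have \<eta>': "\<eta> \<in> hom G (bG\<lparr>carrier := D\<rparr>)" using \<eta> \<eta>D by (auto simp: hom_def)
  have "\<exists>!g. g \<in> continuous_homs bG bT (bG\<lparr>carrier := D\<rparr>) (subtopology bT D) \<and>
      (\<forall>x\<in>carrier G. \<eta> x = g (\<eta> x))"
    by (rule universal_transport[OF b BD \<eta>', of Inr]) simp
  then obtain g where g: "g \<in> continuous_homs bG bT (bG\<lparr>carrier := D\<rparr>) (subtopology bT D)"
    "\<forall>x\<in>carrier G. \<eta> x = g (\<eta> x)" by blast
  have gB: "g \<in> continuous_homs bG bT bG bT"
    using g(1) DB by (auto simp: continuous_homs_def hom_def continuous_map_in_subtopology)
  have "restrict id (carrier bG) \<in> continuous_homs bG bT bG bT"
    using continuous_map_eq[OF continuous_map_id, of bT "restrict id (carrier bG)"]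
    by (auto simp: continuous_homs_def hom_def tsb)
  moreover have "\<forall>x\<in>carrier G. \<eta> x = restrict id (carrier bG) (\<eta> x)"
    using \<eta> by (auto simp: hom_def)
  moreover have "\<exists>!g. g \<in> continuous_homs bG bT bG bT \<and> (\<forall>x\<in>carrier G. \<eta> x = g (\<eta> x))"
    by (rule universal_transport[OF b B \<eta>, of Inr]) simp
  ultimately have eq: "g = restrict id (carrier bG)" using gB g(2) by blast
  have "x \<in> D" if "x \<in> carrier bG" for x
  proof -
    have "g x \<in> D" using g(1) that by (auto simp: continuous_homs_def hom_def)
    then show ?thesis using that by (simp add: eq)
  qed
  then show ?thesis using DB by (auto simp: D_def)
qed

lemma dense_universal:
  fixes G :: "('a, 'm) monoid_scheme" and bG :: "('b, 'n) monoid_scheme"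
    and K :: "('k, 'l) monoid_scheme"
  assumes G: "Group.group G" and B: "compact_Hausdorff_group bG bT" and \<eta>: "\<eta> \<in> hom G bG"
    and dense: "bT closure_of (\<eta> ` carrier G) = carrier bG"
    and small: "\<And>(K' :: 'a set set monoid) T' f'. compact_Hausdorff_group K' T' \<Longrightarrow> f' \<in> hom G K' \<Longrightarrow>
        \<exists>g. g \<in> hom bG K' \<and> continuous_map bT T' g \<and> (\<forall>x\<in>carrier G. f' x = g (\<eta> x))"
    and K: "compact_Hausdorff_group K T" and f: "f \<in> hom G K"
  shows "\<exists>!g. g \<in> continuous_homs bG bT K T \<and> (\<forall>x\<in>carrier G. f x = g (\<eta> x))"
proof -
  interpret B: Group.group bG using compact_Hausdorff_groupD(1)[OF B] .
  have tsb: "topspace bT = carrier bG" using compact_Hausdorff_groupD(2)[OF B] .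
  obtain K' :: "'a set set monoid" and T' f' i where
    *: "compact_Hausdorff_group K' T'" "f' \<in> hom G K'"
    "i \<in> hom K' K" "continuous_map T' T i" "\<And>x. x \<in> carrier G \<Longrightarrow> i (f' x) = f x"
    using small_copy[OF G K f] by metis
  obtain g where g: "g \<in> hom bG K'" "continuous_map bT T' g" "\<forall>x\<in>carrier G. f' x = g (\<eta> x)"
    using small[OF *(1,2)] by blast
  have ig: "i \<circ> g \<in> hom bG K" using g(1) *(3) by (simp add: hom_def Pi_iff)
  show ?thesis
  proof (rule ex_ex1I)
    have "restrict (i \<circ> g) (carrier bG) \<in> hom bG K" using ig by (auto simp: hom_def)
    moreover have "continuous_map bT T (restrict (i \<circ> g) (carrier bG))"
      by (rule continuous_map_eq[OF continuous_map_compose[OF g(2) *(4)]]) (simp add: tsb)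
    moreover have "f x = restrict (i \<circ> g) (carrier bG) (\<eta> x)" if x: "x \<in> carrier G" for x
    proof -
      have "\<eta> x \<in> carrier bG" using x \<eta> by (auto simp: hom_def)
      moreover have "i (g (\<eta> x)) = f x" using g(3) *(5) x by metis
      ultimately show ?thesis by simp
    qed
    ultimately show "\<exists>g. g \<in> continuous_homs bG bT K T \<and> (\<forall>x\<in>carrier G. f x = g (\<eta> x))"
      by (intro exI[of _ "restrict (i \<circ> g) (carrier bG)"]) (simp add: continuous_homs_def)
  next
    fix h k
    assume h: "h \<in> continuous_homs bG bT K T \<and> (\<forall>x\<in>carrier G. f x = h (\<eta> x))"
      and k: "k \<in> continuous_homs bG bT K T \<and> (\<forall>x\<in>carrier G. f x = k (\<eta> x))"
    show "h = k"
    proof (rule extensionalityI)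
      show "h \<in> extensional (carrier bG)" "k \<in> extensional (carrier bG)"
        using h k by (auto simp: continuous_homs_def)
      fix z assume "z \<in> carrier bG"
      then have "z \<in> bT closure_of (\<eta> ` carrier G)" by (simp add: dense)
      then show "h z = k z"
        by (rule forall_in_closure_of_eq[OF _ compact_Hausdorff_groupD(6)[OF K]])
          (use h k in \<open>auto simp: continuous_homs_def\<close>)
    qed
  qed
qed

theorem bohr_compactification_universal:
  fixes G :: "('a, 'm) monoid_scheme" and bG :: "('b, 'n) monoid_scheme"
    and K :: "('k, 'l) monoid_scheme"
  assumes G: "Group.group G" and b: "bohr_compactification G bG bT \<eta>"
    and K: "compact_Hausdorff_group K T" and f: "f \<in> hom G K"
  shows "\<exists>!g. g \<in> continuous_homs bG bT K T \<and> (\<forall>x\<in>carrier G. f x = g (\<eta> x))"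
proof (rule dense_universal[OF G _ _ bohr_compactification_dense[OF G b] _ K f])
  show "compact_Hausdorff_group bG bT" "\<eta> \<in> hom G bG"
    using b by (simp_all add: bohr_compactification_def)
  fix K' :: "'a set set monoid" and T' f'
  assume "compact_Hausdorff_group K' T'" "f' \<in> hom G K'"
  from universal_transport[OF b this, of Inl]
  show "\<exists>g. g \<in> hom bG K' \<and> continuous_map bT T' g \<and> (\<forall>x\<in>carrier G. f' x = g (\<eta> x))"
    by (auto simp: continuous_homs_def)
qed

subsection \<open>Existence\<close>

lemma product_compact_Hausdorff_group:
  assumes "\<And>i. i \<in> I \<Longrightarrow> compact_Hausdorff_group (K i) (T i)"
  shows "compact_Hausdorff_group (product_group I K) (product_topology T I)"
proof -
  note D = compact_Hausdorff_groupD[OF assms]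
  have ts: "topspace (product_topology T I) = carrier (product_group I K)"
    using D(2) by (auto simp: PiE_iff)
  have pr: "continuous_map (product_topology T I) (T i) (\<lambda>x. x i)" if "i \<in> I" for i
    using continuous_map_product_projection[OF that] .
  have m: "continuous_map (prod_topology (product_topology T I) (product_topology T I)) (T i)
      (\<lambda>p. fst p i \<otimes>\<^bsub>K i\<^esub> snd p i)" if i: "i \<in> I" for i
    by (intro continuous_mult[OF assms[OF i]])
      (auto intro: continuous_map_compose[OF continuous_map_fst pr[OF i], unfolded o_def]
        continuous_map_compose[OF continuous_map_snd pr[OF i], unfolded o_def])
  have "continuous_map (prod_topology (product_topology T I) (product_topology T I))
      (product_topology T I) (\<lambda>(x, y). x \<otimes>\<^bsub>product_group I K\<^esub> y)"
    unfolding continuous_map_componentwise using m by (auto simp: case_prod_unfold)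
  moreover have "continuous_map (product_topology T I) (product_topology T I)
      (\<lambda>x. inv\<^bsub>product_group I K\<^esub> x)"
  proof (rule continuous_map_eq[of _ _ "\<lambda>x. \<lambda>i\<in>I. inv\<^bsub>K i\<^esub> x i"])
    show "continuous_map (product_topology T I) (product_topology T I) (\<lambda>x. \<lambda>i\<in>I. inv\<^bsub>K i\<^esub> x i)"
      unfolding continuous_map_componentwise
      using continuous_map_compose[OF pr D(4), unfolded o_def] by auto
    fix x assume "x \<in> topspace (product_topology T I)"
    then have "x \<in> (\<Pi>\<^sub>E i\<in>I. carrier (K i))" unfolding ts by simp
    then show "(\<lambda>i\<in>I. inv\<^bsub>K i\<^esub> x i) = inv\<^bsub>product_group I K\<^esub> x"
      using D(1) by simp
  qed
  moreover have "compact_space (product_topology T I)" "Hausdorff_space (product_topology T I)"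
    using D(5,6) by (auto simp: compact_space_product_topology Hausdorff_space_product_topology)
  ultimately show ?thesis
    unfolding compact_Hausdorff_group_def topological_group_def
    using ts D(1) by auto
qed

theorem bohr_compactification_exists:
  fixes G :: "('a, 'm) monoid_scheme"
  assumes G: "Group.group G"
  shows "\<exists>(bG :: ('a set set monoid \<times> 'a set set topology \<times> ('a \<Rightarrow> 'a set set) \<Rightarrow> 'a set set) monoid)
           bT \<eta>. bohr_compactification G bG bT \<eta>"
proof -
  define I :: "('a set set monoid \<times> 'a set set topology \<times> ('a \<Rightarrow> 'a set set)) set" where
    "I = {(K, T, f). compact_Hausdorff_group K T \<and> f \<in> hom G K}"
  let ?P = "product_group I fst" and ?T = "product_topology (\<lambda>i. fst (snd i)) I"
  have P: "compact_Hausdorff_group ?P ?T"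
    by (rule product_compact_Hausdorff_group) (auto simp: I_def)
  define \<eta> where "\<eta> = (\<lambda>x. \<lambda>i\<in>I. snd (snd i) x)"
  have \<eta>P: "\<eta> \<in> hom G ?P" 
  proof (rule homI)
    have I: "snd (snd i) \<in> hom G (fst i)" if "i \<in> I" for i using that by (auto simp: I_def)
    show "\<eta> x \<in> carrier ?P" if "x \<in> carrier G" for x
      using I that by (simp add: \<eta>_def hom_def Pi_iff)
    show "\<eta> (x \<otimes>\<^bsub>G\<^esub> y) = \<eta> x \<otimes>\<^bsub>?P\<^esub> \<eta> y" if "x \<in> carrier G" "y \<in> carrier G" for x y
      unfolding \<eta>_def mult_product_group
      by (rule restrict_ext) (use I that in \<open>simp add: hom_def\<close>)
  qed
  define D where "D = ?T closure_of (\<eta> ` carrier G)"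
  have sub: "subgroup D ?P"
    unfolding D_def
    by (intro closure_subgroup[OF P] hom_image_subgroup[OF G compact_Hausdorff_groupD(1)[OF P] \<eta>P])
  have DP: "D \<subseteq> carrier ?P" using subgroup.subset[OF sub] .
  have \<eta>im: "\<eta> ` carrier G \<subseteq> D"
    unfolding D_def using \<eta>P compact_Hausdorff_groupD(2)[OF P]
    by (intro closure_of_subset) (auto simp: hom_def)
  let ?B = "?P\<lparr>carrier := D\<rparr>" and ?S = "subtopology ?T D"
  have B: "compact_Hausdorff_group ?B ?S"
    by (rule closed_subgroup[OF P sub]) (simp add: D_def)
  have \<eta>B: "\<eta> \<in> hom G ?B" using \<eta>P \<eta>im by (auto simp: hom_def)
  have dense: "?S closure_of (\<eta> ` carrier G) = carrier ?B"
    using \<eta>im by (simp add: closure_of_subtopology D_def[symmetric] Int_absorb1)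
  have small: "\<exists>g. g \<in> hom ?B K \<and> continuous_map ?S T g \<and> (\<forall>x\<in>carrier G. f x = g (\<eta> x))"
    if "compact_Hausdorff_group K T" "f \<in> hom G K" for K :: "'a set set monoid" and T f
  proof (intro exI conjI)
    have i: "(K, T, f) \<in> I" using that by (simp add: I_def)
    show "(\<lambda>x. x (K, T, f)) \<in> hom ?B K"
    proof (rule homI)
      show "x (K, T, f) \<in> carrier K" if "x \<in> carrier ?B" for x
        using that DP PiE_mem[OF _ i, of x "\<lambda>i. carrier (fst i)"] by auto
    qed (use i in simp)
    show "continuous_map ?S T (\<lambda>x. x (K, T, f))"
      using continuous_map_from_subtopology[OF continuous_map_product_projection[OF i], of "\<lambda>i. fst (snd i)" D]
      by simp
    show "\<forall>x\<in>carrier G. f x = \<eta> x (K, T, f)" using i by (simp add: \<eta>_def)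
  qed
  have "bohr_compactification G ?B ?S \<eta>"
    unfolding bohr_compactification_def
    using B \<eta>B dense_universal[OF G B \<eta>B dense small] by blast
  then show ?thesis by blast
qed

end

theory Submission
  imports Defs "HOL-Algebra.Bij" "HOL-Probability.Discrete_Topology"
begin

text \<open>
  Let \<open>L\<close> and \<open>M\<close> be left-invariant means on the bounded functions on \<open>G\<close> with \<open>L 1\<^sub>A > 0\<close> and
  \<open>M 1\<^sub>B > 0\<close>. Integrating a function on \<open>G \<times> G\<close> first by \<open>M\<close> and then by \<open>L\<close> gives a mean \<open>J\<close>,
  and \<open>\<langle>f, t\<rangle> = J (f * t)\<close> is a positive semidefinite form that is invariant under the diagonal
  translations. Write \<open>e a b\<close> for the indicator function of \<open>aA \<times> bB\<close>. If \<open>\<langle>e h h, e 1 g\<rangle> > 0\<close>, then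
  some \<open>x\<close> lies in \<open>hA \<inter> A\<close> and some \<open>y\<close> in \<open>hB \<inter> gB\<close>, so that \<open>h \<in> A A\<inverse>\<close>, \<open>h\<inverse> g \<in> B B\<inverse>\<close> and
  \<open>g \<in> A A\<inverse> B B\<inverse>\<close>. The same conclusion follows from \<open>\<langle>f, e 1 g\<rangle> > 0\<close> for a convex combination
  \<open>f\<close> of the vectors \<open>e h h\<close>.

  Let \<open>T\<close> be the vector of least norm in the closed convex hull of all \<open>e h h\<close>, and put
  \<open>c g = \<langle>T, e 1 g\<rangle>\<close>. Then \<open>c g > 0\<close> implies \<open>g \<in> A A\<inverse> B B\<inverse>\<close>. Uniqueness makes \<open>T\<close> invariant
  under diagonal translations. Hence \<open>\<langle>T, e h h\<rangle>\<close> is the same number \<open>c 1\<close> for every \<open>h\<close>, and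
  this number is \<open>\<langle>T, T\<rangle>\<close>; it is positive because \<open>\<langle>f, f\<rangle> \<ge> (J f)\<^sup>2 = (L 1\<^sub>A * M 1\<^sub>B)\<^sup>2\<close> on the hull.
  Invariance also gives \<open>c (x g) = \<langle>T, e x\<inverse> g\<rangle>\<close>. Up to a uniform error \<open>T\<close> may be replaced here by
  a finite combination of the \<open>e h h\<close>, and \<open>\<langle>e h h, e a g\<rangle>\<close> is a product of a number in \<open>[0, 1]\<close>
  depending on \<open>a\<close> and one depending on \<open>g\<close>. Hence the functions \<open>x \<mapsto> c (x g)\<close>, for \<open>g \<in> G\<close>,
  form a totally bounded set in the supremum norm.

  The closure \<open>X\<close> of that set is compact, and \<open>G\<close> acts on it by isometries. The isometry group of a
  compact metric space, with the topology of pointwise convergence, is a compact Hausdorff group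
  (\<open>compact_Hausdorff_isometry_group\<close>), so this action factors through the Bohr compactification.
  Therefore \<open>{g. c g > 0}\<close> is open in the Bohr topology (\<open>openin_bohr_almost_periodic\<close>). It contains
  the unit and is contained in \<open>A A\<inverse> B B\<inverse>\<close>.

  The density \<open>sigma_R\<close> tests \<open>A\<close> against finite sets and not against finitely supported measures,
  so \<open>L\<close> is obtained (\<open>invariant_mean_positive\<close>) as an ultrafilter limit of averages over right
  translates of Folner sets, each translate chosen so that it meets \<open>A\<close> in a positive proportion.
  Folner sets exist (\<open>amenable_Folner\<close>), because otherwise some finite \<open>S\<close> would satisfy
  \<open>card (S F) \<ge> 2 * card F\<close> for all finite \<open>F\<close>, and the marriage theorem would turn \<open>S\<close> into a
  paradoxical decomposition of \<open>G\<close>.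
\<close>

section \<open>Systems of distinct representatives\<close>

text \<open>Rado's proof of the marriage theorem, which needs no bound on the size of \<open>I\<close>. Because the sets
  are finite, the Hall condition survives intersections of chains, so Zorn's lemma gives a minimal
  relation \<open>R\<close> below the given one that still satisfies it. If some \<open>R `` {i}\<close> had two elements
  \<open>x\<close> and \<open>y\<close>, then deleting either of them would violate the condition at finite sets \<open>J\<close> and \<open>L\<close>;
  submodularity of cardinality, applied to these two violations, contradicts the condition for \<open>R\<close>.
  So \<open>R\<close> is a function, and the condition for two-element sets says that it is injective.\<close>

lemma hall_marriage:
  fixes A :: "'i \<Rightarrow> 'v set"
  assumes fin: "\<And>i. i \<in> I \<Longrightarrow> finite (A i)"
    and hall: "\<And>J. J \<subseteq> I \<Longrightarrow> finite J \<Longrightarrow> card J \<le> card (\<Union>(A ` J))"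
  obtains f where "inj_on f I" "\<And>i. i \<in> I \<Longrightarrow> f i \<in> A i"
proof -
  define hallcond where
    "hallcond R \<longleftrightarrow> (\<forall>J. J \<subseteq> I \<longrightarrow> finite J \<longrightarrow> card J \<le> card (R `` J))" for R :: "('i \<times> 'v) set"
  \<comment> \<open>Zorn is applied to the sets of deleted pairs, so that minimal relations become maximal sets.\<close>
  define \<A> where "\<A> = {S. S \<subseteq> Sigma I A \<and> hallcond (Sigma I A - S)}"
  have "Sigma I A `` J = \<Union>(A ` J)" if "J \<subseteq> I" for J using that by auto
  then have "{} \<in> \<A>" using hall by (simp add: \<A>_def hallcond_def)
  moreover have "\<Union>C \<in> \<A>" if C: "C \<noteq> {}" "subset.chain \<A> C" for C
  proof -
    have "card J \<le> card ((Sigma I A - \<Union>C) `` J)" if J: "J \<subseteq> I" "finite J" for J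
    proof -
      have "finite (\<Union>C \<inter> Sigma J A)" using J fin by (intro finite_Int disjI2 finite_SigmaI) auto
      then obtain S where S: "S \<in> C" "\<Union>C \<inter> Sigma J A \<subseteq> S"
        using finite_subset_Union_chain[of "\<Union>C \<inter> Sigma J A" C \<A>] C by blast
      then have "(Sigma I A - S) `` J = (Sigma I A - \<Union>C) `` J" by blast
      moreover have "hallcond (Sigma I A - S)"
        using S(1) C(2) by (auto simp: \<A>_def subset.chain_def)
      ultimately show ?thesis using J unfolding hallcond_def by metis
    qed
    moreover have "\<Union>C \<subseteq> Sigma I A" using C(2) by (auto simp: \<A>_def subset.chain_def)
    ultimately show ?thesis by (simp add: \<A>_def hallcond_def)
  qed
  ultimately obtain M where M: "M \<in> \<A>" "\<And>S. S \<in> \<A> \<Longrightarrow> M \<subseteq> S \<Longrightarrow> S = M"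
    using subset_Zorn_nonempty[of \<A>] by blast
  define R where "R = Sigma I A - M"
  have R: "card J \<le> card (R `` J)" if "J \<subseteq> I" "finite J" for J
    using M(1) that by (simp add: \<A>_def R_def hallcond_def)
  have Rfin: "finite (R `` J)" if "J \<subseteq> I" "finite J" for J
    using that fin by (intro finite_subset[of "R `` J" "\<Union>(A ` J)"]) (auto simp: R_def)
  have remove: "\<exists>J. J \<subseteq> I - {i} \<and> finite J \<and> card (R `` J \<union> (R `` {i} - {x})) \<le> card J"
    if ix: "(i, x) \<in> R" for i x
  proof -
    have "insert (i, x) M \<notin> \<A>" using M(2) ix by (auto simp: R_def)
    moreover have "insert (i, x) M \<subseteq> Sigma I A" using M(1) ix by (auto simp: \<A>_def R_def)
    moreover have "Sigma I A - insert (i, x) M = R - {(i, x)}" by (auto simp: R_def)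
    ultimately have "\<not> hallcond (R - {(i, x)})" by (simp add: \<A>_def)
    then obtain J where J: "J \<subseteq> I" "finite J" "card ((R - {(i, x)}) `` J) < card J"
      unfolding hallcond_def by (meson not_le)
    have iJ: "i \<in> J"
    proof (rule ccontr)
      assume "i \<notin> J"
      then have "(R - {(i, x)}) `` J = R `` J" by blast
      then show False using R[OF J(1,2)] J(3) by simp
    qed
    have sub: "R `` (J - {i}) \<union> (R `` {i} - {x}) \<subseteq> (R - {(i, x)}) `` J" using iJ by auto
    have "finite ((R - {(i, x)}) `` J)" using Rfin[OF J(1,2)] by (rule finite_subset[rotated]) auto
    from card_mono[OF this sub] have "card (R `` (J - {i}) \<union> (R `` {i} - {x})) < card J"
      using J(3) by simp
    then have "card (R `` (J - {i}) \<union> (R `` {i} - {x})) \<le> card (J - {i})"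
      using iJ J(2) by simp
    then show ?thesis using J by (intro exI[of _ "J - {i}"]) auto
  qed
  have single: "x = y" if ix: "(i, x) \<in> R" and iy: "(i, y) \<in> R" for i x y
  proof (rule ccontr)
    assume xy: "x \<noteq> y"
    have i: "i \<in> I" using ix by (auto simp: R_def)
    obtain J where J: "J \<subseteq> I - {i}" "finite J" "card (R `` J \<union> (R `` {i} - {x})) \<le> card J"
      using remove[OF ix] by blast
    obtain L where L: "L \<subseteq> I - {i}" "finite L" "card (R `` L \<union> (R `` {i} - {y})) \<le> card L"
      using remove[OF iy] by blast
    let ?U = "R `` J \<union> (R `` {i} - {x})" and ?V = "R `` L \<union> (R `` {i} - {y})"
    have fin': "finite ?U" "finite ?V" using Rfin J L i by auto
    have "card (insert i (J \<union> L)) \<le> card (R `` insert i (J \<union> L))"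
      using J L i by (intro R) auto
    also have "R `` insert i (J \<union> L) = ?U \<union> ?V" using xy by auto
    finally have 1: "Suc (card (J \<union> L)) \<le> card (?U \<union> ?V)"
      using J L by (subst (asm) card_insert_disjoint) auto
    have "card (J \<inter> L) \<le> card (R `` (J \<inter> L))"
      using J L by (intro R) auto
    also have "\<dots> \<le> card (?U \<inter> ?V)" using fin' by (intro card_mono) auto
    finally have "Suc (card (J \<union> L) + card (J \<inter> L)) \<le> card (?U \<union> ?V) + card (?U \<inter> ?V)" using 1 by simp
    also have "\<dots> = card ?U + card ?V" using card_Un_Int[OF fin'] by simp
    also have "\<dots> \<le> card J + card L" using J L by simp
    finally show False using card_Un_Int[OF J(2) L(2)] by simp
  qed
  have ex: "\<exists>x. (i, x) \<in> R" if "i \<in> I" for i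
  proof -
    have "card {i} \<le> card (R `` {i})" using that by (intro R) auto
    then have "R `` {i} \<noteq> {}" by fastforce
    then show ?thesis by blast
  qed
  define f where "f i = (SOME x. (i, x) \<in> R)" for i
  have f: "(i, f i) \<in> R" if "i \<in> I" for i
    unfolding f_def using ex[OF that] by (rule someI_ex)
  have "inj_on f I"
  proof (rule inj_onI, rule ccontr)
    fix i j assume ij: "i \<in> I" "j \<in> I" "f i = f j" "i \<noteq> j"
    have "R `` {i, j} = {f i}"
      using f[OF ij(1)] f[OF ij(2)] ij(3) single by auto
    moreover have "card {i, j} \<le> card (R `` {i, j})" using ij by (intro R) auto
    ultimately show False using ij by simp
  qed
  moreover have "f i \<in> A i" if "i \<in> I" for i using f[OF that] by (auto simp: R_def)
  ultimately show ?thesis using that by blast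
qed

section \<open>Folner sets in amenable groups\<close>

text \<open>If \<open>S\<close> doubled every finite set, then the marriage theorem would give an injection
  \<open>f : G \<times> {0, 1} \<rightarrow> G\<close> with \<open>f (g, i) \<in> S g\<close>. Each of the two copies of \<open>G\<close> is covered by the pieces
  on which \<open>f\<close> is left multiplication by a fixed \<open>s \<in> S\<close>, and the images \<open>s E\<close> of all the pieces are
  pairwise disjoint. An invariant measure of total mass 1 would thus have mass at least 2.\<close>

lemma amenable_no_doubling:
  fixes G :: "('a, 'm) monoid_scheme"
  assumes am: "amenable_group G" and S: "finite S" "S \<subseteq> carrier G"
  shows "\<exists>F. finite F \<and> F \<subseteq> carrier G \<and> card (S <#>\<^bsub>G\<^esub> F) < 2 * card F"
proof (rule ccontr)
  assume "\<not> ?thesis"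
  then have double: "2 * card F \<le> card (S <#>\<^bsub>G\<^esub> F)" if "finite F" "F \<subseteq> carrier G" for F
    using that by (meson not_le)
  have "group G" using am by (simp add: amenable_group_def)
  then interpret group G .
  obtain \<mu> :: "'a set \<Rightarrow> real" where \<mu>: "\<forall>A. A \<subseteq> carrier G \<longrightarrow> 0 \<le> \<mu> A" "\<mu> (carrier G) = 1"
    "\<forall>A B. A \<subseteq> carrier G \<longrightarrow> B \<subseteq> carrier G \<longrightarrow> A \<inter> B = {} \<longrightarrow> \<mu> (A \<union> B) = \<mu> A + \<mu> B"
    "\<forall>g A. g \<in> carrier G \<longrightarrow> A \<subseteq> carrier G \<longrightarrow> \<mu> (g <#\<^bsub>G\<^esub> A) = \<mu> A"
    using am unfolding amenable_group_def by (elim conjE exE)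
  note pos = \<mu>(1)[rule_format] and one = \<mu>(2) and add = \<mu>(3)[rule_format]
    and inv = \<mu>(4)[rule_format]
  have mono: "\<mu> A \<le> \<mu> B" if "A \<subseteq> B" "B \<subseteq> carrier G" for A B
  proof -
    have "A \<union> (B - A) = B" "A \<subseteq> carrier G" "B - A \<subseteq> carrier G" using that by auto
    then show ?thesis using add[of A "B - A"] pos[of "B - A"] by simp
  qed
  have empty: "\<mu> {} = 0" using add[of "{}" "{}"] by simp
  have subadd: "\<mu> (\<Union>(E ` T)) \<le> (\<Sum>t\<in>T. \<mu> (E t))"
    if "finite T" "\<And>t. t \<in> T \<Longrightarrow> E t \<subseteq> carrier G" for T :: "'a set" and E
    using that
  proof (induction T rule: finite_induct)
    case (insert t T)
    have "\<mu> (\<Union>(E ` insert t T)) = \<mu> (E t \<union> (\<Union>(E ` T) - E t))" by (simp add: Un_commute)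
    also have "\<dots> = \<mu> (E t) + \<mu> (\<Union>(E ` T) - E t)"
      using insert.prems by (intro add) auto
    also have "\<mu> (\<Union>(E ` T) - E t) \<le> \<mu> (\<Union>(E ` T))"
      using insert.prems by (intro mono) auto
    finally show ?case using insert by fastforce
  qed (simp add: empty)
  have additive: "\<mu> (\<Union>(E ` T)) = (\<Sum>t\<in>T. \<mu> (E t))"
    if "finite T" "\<And>t. t \<in> T \<Longrightarrow> E t \<subseteq> carrier G" "disjoint_family_on E T"
    for T :: "(bool \<times> 'a) set" and E
    using that
  proof (induction T rule: finite_induct)
    case (insert t T)
    have "E t \<subseteq> carrier G" "\<Union>(E ` T) \<subseteq> carrier G" using insert.prems(1) by blast+
    moreover have "E t \<inter> \<Union>(E ` T) = {}"
    proof -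
      have "E t \<inter> E s = {}" if "s \<in> T" for s
        using disjoint_family_onD[OF insert.prems(2), of t s] insert.hyps(2) that by blast
      then show ?thesis by blast
    qed
    ultimately have "\<mu> (E t \<union> \<Union>(E ` T)) = \<mu> (E t) + \<mu> (\<Union>(E ` T))"
      by (rule add)
    moreover have "\<mu> (\<Union>(E ` T)) = (\<Sum>t\<in>T. \<mu> (E t))"
      using insert.prems by (intro insert.IH) (auto intro: disjoint_family_on_mono[of T "insert t T"])
    ultimately show ?case using insert.hyps by simp
  qed (simp add: empty)
  define I where "I = carrier G \<times> (UNIV :: bool set)"
  define N where "N p = (\<lambda>s. s \<otimes>\<^bsub>G\<^esub> fst p) ` S" for p :: "'a \<times> bool"
  obtain f where f: "inj_on f I" "\<And>p. p \<in> I \<Longrightarrow> f p \<in> N p"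
  proof (rule hall_marriage)
    fix J :: "('a \<times> bool) set" assume J: "J \<subseteq> I" "finite J"
    have "card J \<le> card (fst ` J \<times> (UNIV :: bool set))"
      using J(2) by (intro card_mono) (auto simp: rev_image_eqI)
    also have "\<dots> = 2 * card (fst ` J)" by (simp add: card_cartesian_product)
    also have "\<dots> \<le> card (S <#>\<^bsub>G\<^esub> fst ` J)" using J by (intro double) (auto simp: I_def)
    also have "S <#>\<^bsub>G\<^esub> fst ` J = \<Union>(N ` J)" by (auto simp: set_mult_def N_def)
    finally show "card J \<le> card (\<Union>(N ` J))" .
  qed (use S in \<open>auto simp: N_def\<close>)
  define E where "E p = {g \<in> carrier G. f (g, fst p) = snd p \<otimes>\<^bsub>G\<^esub> g}" for p :: "bool \<times> 'a"
  have E: "E p \<subseteq> carrier G" for p by (auto simp: E_def)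
  have full: "1 \<le> (\<Sum>s\<in>S. \<mu> (E (i, s)))" for i
  proof -
    have "carrier G \<subseteq> \<Union>((\<lambda>s. E (i, s)) ` S)" using f(2) by (force simp: I_def N_def E_def)
    then have "\<Union>((\<lambda>s. E (i, s)) ` S) = carrier G" using E by blast
    then have "1 \<le> \<mu> (\<Union>((\<lambda>s. E (i, s)) ` S))" by (simp only: one)
    also have "\<dots> \<le> (\<Sum>s\<in>S. \<mu> (E (i, s)))" using S(1) E by (intro subadd) auto
    finally show ?thesis .
  qed
  define T where "T = (UNIV :: bool set) \<times> S"
  have disj: "disjoint_family_on (\<lambda>p. snd p <#\<^bsub>G\<^esub> E p) T"
    unfolding disjoint_family_on_def
  proof (intro ballI impI, rule ccontr)
    fix p q assume pq: "p \<in> T" "q \<in> T" "p \<noteq> q" "(snd p <#\<^bsub>G\<^esub> E p) \<inter> (snd q <#\<^bsub>G\<^esub> E q) \<noteq> {}"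
    then obtain g h where gh: "g \<in> E p" "h \<in> E q" "snd p \<otimes>\<^bsub>G\<^esub> g = snd q \<otimes>\<^bsub>G\<^esub> h"
      by (auto simp: l_coset_def)
    then have "f (g, fst p) = f (h, fst q)" by (simp add: E_def)
    moreover have "(g, fst p) \<in> I" "(h, fst q) \<in> I" using gh(1,2) by (simp_all add: I_def E_def)
    ultimately have "(g, fst p) = (h, fst q)" by (rule inj_onD[OF f(1)])
    then have "g = h" "fst p = fst q" by simp_all
    moreover have "snd p \<in> carrier G" "snd q \<in> carrier G" using pq S(2) by (auto simp: T_def)
    ultimately have "snd p = snd q" using gh E by (metis in_mono right_cancel)
    then show False using \<open>fst p = fst q\<close> pq(3) by (simp add: prod_eq_iff)
  qed
  have Tc: "snd p \<in> carrier G" if "p \<in> T" for p using that S(2) by (auto simp: T_def)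
  have "2 \<le> (\<Sum>i\<in>(UNIV :: bool set). \<Sum>s\<in>S. \<mu> (E (i, s)))"
    using full[of True] full[of False] by (simp add: UNIV_bool)
  also have "\<dots> = (\<Sum>p\<in>T. \<mu> (E p))" by (simp add: T_def sum.cartesian_product)
  also have "\<dots> = (\<Sum>p\<in>T. \<mu> (snd p <#\<^bsub>G\<^esub> E p))" using Tc E by (simp add: inv)
  also have "\<dots> = \<mu> (\<Union>((\<lambda>p. snd p <#\<^bsub>G\<^esub> E p) ` T))"
    using S(1) Tc E l_coset_subset_G by (intro additive[symmetric] disj) (auto simp: T_def)
  also have "\<dots> \<le> \<mu> (carrier G)"
    using Tc E by (intro mono UN_least l_coset_subset_G) auto
  finally show False by (simp add: one)
qed

text \<open>If the Folner condition fails for \<open>K\<close> and \<open>\<epsilon>\<close>, then multiplication by \<open>K \<union> {1}\<close> enlarges every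
  finite set by the factor \<open>1 + \<epsilon>\<close>, and a power of \<open>K \<union> {1}\<close> doubles every finite set.\<close>

lemma amenable_Folner:
  fixes G :: "('a, 'm) monoid_scheme" and \<epsilon> :: real
  assumes am: "amenable_group G" and K: "finite K" "K \<subseteq> carrier G" and \<epsilon>: "\<epsilon> > 0"
  shows "\<exists>F. finite F \<and> F \<noteq> {} \<and> F \<subseteq> carrier G \<and>
    (\<forall>k\<in>K. real (card ((k <#\<^bsub>G\<^esub> F) - F)) \<le> \<epsilon> * card F)"
proof (rule ccontr)
  assume no: "\<not> ?thesis"
  have "group G" using am by (simp add: amenable_group_def)
  then interpret group G .
  have bad: "\<exists>k\<in>K. \<epsilon> * card F < real (card ((k <#\<^bsub>G\<^esub> F) - F))"
    if "finite F" "F \<noteq> {}" "F \<subseteq> carrier G" for F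
    using that no by (meson not_le)
  define K' where "K' = insert \<one>\<^bsub>G\<^esub> K"
  have K': "finite K'" "K' \<subseteq> carrier G" using K by (auto simp: K'_def)
  have fin: "finite (P <#>\<^bsub>G\<^esub> Q)" if "finite P" "finite Q" for P Q
    using that by (simp add: set_mult_def)
  have grow: "(1 + \<epsilon>) * card F \<le> card (K' <#>\<^bsub>G\<^esub> F)" if F: "finite F" "F \<subseteq> carrier G" for F
  proof (cases "F = {}")
    case False
    then obtain k where k: "k \<in> K" "\<epsilon> * card F < real (card ((k <#\<^bsub>G\<^esub> F) - F))"
      using bad F by blast
    have "F \<subseteq> K' <#>\<^bsub>G\<^esub> F" using F(2) by (force simp: set_mult_def K'_def)
    moreover have "k <#\<^bsub>G\<^esub> F \<subseteq> K' <#>\<^bsub>G\<^esub> F" using k(1) by (force simp: set_mult_def l_coset_def K'_def)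
    ultimately have "card (F \<union> ((k <#\<^bsub>G\<^esub> F) - F)) \<le> card (K' <#>\<^bsub>G\<^esub> F)"
      using fin[OF K'(1) F(1)] by (intro card_mono) auto
    moreover have "card (F \<union> ((k <#\<^bsub>G\<^esub> F) - F)) = card F + card ((k <#\<^bsub>G\<^esub> F) - F)"
      using F(1) by (intro card_Un_disjoint) (auto simp: l_coset_def)
    ultimately show ?thesis using k(2) by (simp add: algebra_simps)
  qed simp
  define S where "S n = ((\<lambda>P. K' <#>\<^bsub>G\<^esub> P) ^^ n) {\<one>\<^bsub>G\<^esub>}" for n
  have S: "finite (S n) \<and> S n \<subseteq> carrier G" for n
    by (induction n) (use K' fin set_mult_closed in \<open>auto simp: S_def\<close>)
  have "(1 + \<epsilon>) ^ n * card F \<le> card (S n <#>\<^bsub>G\<^esub> F)" if F: "finite F" "F \<subseteq> carrier G" for n F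
  proof (induction n)
    case 0
    have "{\<one>\<^bsub>G\<^esub>} <#>\<^bsub>G\<^esub> F = F" using F(2) by (force simp: set_mult_def)
    then show ?case by (simp add: S_def)
  next
    case (Suc n)
    have "(1 + \<epsilon>) ^ Suc n * card F = (1 + \<epsilon>) * ((1 + \<epsilon>) ^ n * card F)" by simp
    also have "\<dots> \<le> (1 + \<epsilon>) * card (S n <#>\<^bsub>G\<^esub> F)" using Suc \<epsilon> by (intro mult_left_mono) auto
    also have "\<dots> \<le> card (K' <#>\<^bsub>G\<^esub> (S n <#>\<^bsub>G\<^esub> F))"
      using S F fin set_mult_closed by (intro grow) auto
    also have "K' <#>\<^bsub>G\<^esub> (S n <#>\<^bsub>G\<^esub> F) = S (Suc n) <#>\<^bsub>G\<^esub> F"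
      using set_mult_assoc[OF K'(2) conjunct2[OF S[of n]] F(2)] by (simp add: S_def)
    finally show ?case .
  qed
  moreover obtain n where n: "2 < (1 + \<epsilon>) ^ n" using real_arch_pow[of "1 + \<epsilon>" 2] \<epsilon> by auto
  moreover obtain F where F: "finite F" "F \<subseteq> carrier G" "card (S n <#>\<^bsub>G\<^esub> F) < 2 * card F"
    using amenable_no_doubling[OF am] S by meson
  ultimately have "(1 + \<epsilon>) ^ n * card F < 2 * card F"
    by (smt (verit) of_nat_less_iff of_nat_mult of_nat_numeral)
  then show False using n by (simp add: mult_less_cancel_right)
qed

section \<open>Means on bounded functions\<close>

definition bounded_on :: "'x set \<Rightarrow> ('x \<Rightarrow> real) \<Rightarrow> bool" where
  "bounded_on X f \<longleftrightarrow> (\<exists>B. \<forall>x\<in>X. \<bar>f x\<bar> \<le> B)"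

lemma bounded_onI: "(\<And>x. x \<in> X \<Longrightarrow> \<bar>f x\<bar> \<le> B) \<Longrightarrow> bounded_on X f"
  by (auto simp: bounded_on_def)

lemma bounded_on_intros [intro, simp]:
  "bounded_on X (\<lambda>_. c)"
  "bounded_on X f \<Longrightarrow> bounded_on X g \<Longrightarrow> bounded_on X (\<lambda>x. f x + g x)"
  "bounded_on X f \<Longrightarrow> bounded_on X g \<Longrightarrow> bounded_on X (\<lambda>x. f x - g x)"
  "bounded_on X f \<Longrightarrow> bounded_on X g \<Longrightarrow> bounded_on X (\<lambda>x. f x * g x)"
  "bounded_on X f \<Longrightarrow> bounded_on X (\<lambda>x. f x ^ n)"
proof -
  show "bounded_on X (\<lambda>_. c)" by (auto simp: bounded_on_def)
  show "bounded_on X (\<lambda>x. f x + g x)" if "bounded_on X f" "bounded_on X g"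
    using that unfolding bounded_on_def by (meson abs_triangle_ineq add_mono order_trans)
  show "bounded_on X (\<lambda>x. f x - g x)" if "bounded_on X f" "bounded_on X g"
    using that unfolding bounded_on_def by (meson abs_triangle_ineq4 add_mono order_trans)
  show "bounded_on X (\<lambda>x. f x * g x)" if fg: "bounded_on X f" "bounded_on X g"
  proof -
    obtain B C where "\<forall>x\<in>X. \<bar>f x\<bar> \<le> B" "\<forall>x\<in>X. \<bar>g x\<bar> \<le> C" using fg by (auto simp: bounded_on_def)
    then have "\<bar>f x * g x\<bar> \<le> B * C" if "x \<in> X" for x
      using that by (simp add: abs_mult mult_mono')
    then show ?thesis by (rule bounded_onI)
  qed
  show "bounded_on X (\<lambda>x. f x ^ n)" if f: "bounded_on X f"
  proof -
    obtain B where "\<forall>x\<in>X. \<bar>f x\<bar> \<le> B" using f by (auto simp: bounded_on_def)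
    then have "\<bar>f x ^ n\<bar> \<le> B ^ n" if "x \<in> X" for x
      using that by (simp add: power_abs power_mono)
    then show ?thesis by (rule bounded_onI)
  qed
qed

text \<open>A mean is modelled as a functional on all real functions that is constrained only on those
  bounded on \<open>X\<close>, where it is the integral of a finitely additive probability measure.\<close>

locale mean =
  fixes X :: "'x set" and L :: "('x \<Rightarrow> real) \<Rightarrow> real"
  assumes add: "bounded_on X f \<Longrightarrow> bounded_on X g \<Longrightarrow> L (\<lambda>x. f x + g x) = L f + L g"
    and scale: "bounded_on X f \<Longrightarrow> L (\<lambda>x. c * f x) = c * L f"
    and mono: "bounded_on X f \<Longrightarrow> bounded_on X g \<Longrightarrow> (\<And>x. x \<in> X \<Longrightarrow> f x \<le> g x) \<Longrightarrow> L f \<le> L g"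
    and one: "L (\<lambda>_. 1) = 1"
begin

lemma const: "L (\<lambda>_. c) = c"
  using scale[of "\<lambda>_. 1" c] by (simp add: one)

lemma diff: "bounded_on X f \<Longrightarrow> bounded_on X g \<Longrightarrow> L (\<lambda>x. f x - g x) = L f - L g"
  using add[of "\<lambda>x. f x - g x" g] by simp

lemma cong: 
  assumes "bounded_on X f" "\<And>x. x \<in> X \<Longrightarrow> f x = g x"
  shows "L f = L g"
proof -
  have "bounded_on X g" using assms by (simp add: bounded_on_def)
  then show ?thesis using assms by (intro antisym mono) auto
qed

lemma bounds:
  assumes "\<And>x. x \<in> X \<Longrightarrow> 0 \<le> f x" "\<And>x. x \<in> X \<Longrightarrow> f x \<le> 1"
  shows "0 \<le> L f" "L f \<le> 1"
proof -
  have f: "bounded_on X f" by (rule bounded_onI[of _ _ 1]) (use assms in auto)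
  show "0 \<le> L f" using mono[of "\<lambda>_. 0" f] f assms by (simp add: const)
  show "L f \<le> 1" using mono[of f "\<lambda>_. 1"] f assms by (simp add: const)
qed

lemma positive_imp_ex:
  assumes "bounded_on X f" "0 < L f"
  obtains x where "x \<in> X" "0 < f x"
  using mono[OF assms(1), of "\<lambda>_. 0"] assms(2) const by (metis bounded_on_intros(1) not_le)

lemma variance:
  assumes f: "bounded_on X f"
  shows "(L f)\<^sup>2 \<le> L (\<lambda>x. (f x)\<^sup>2)"
proof -
  have "0 \<le> L (\<lambda>x. (f x - L f)\<^sup>2)"
    using mono[of "\<lambda>_. 0" "\<lambda>x. (f x - L f)\<^sup>2"] f by (simp add: const)
  also have "(\<lambda>x. (f x - L f)\<^sup>2) = (\<lambda>x. ((f x)\<^sup>2 - (2 * L f) * f x) + (L f)\<^sup>2)"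
    by (auto simp: power2_eq_square algebra_simps)
  also have "L \<dots> = L (\<lambda>x. (f x)\<^sup>2) - (2 * L f) * L f + (L f)\<^sup>2"
    using f by (simp add: add diff scale const)
  finally show ?thesis by (simp add: power2_eq_square)
qed

end

lemma (in mean) bounded_on_section:
  assumes f: "bounded_on (Y \<times> X) f"
  shows "bounded_on Y (\<lambda>y. L (\<lambda>x. f (y, x)))"
proof -
  obtain B where B: "\<And>y x. y \<in> Y \<Longrightarrow> x \<in> X \<Longrightarrow> \<bar>f (y, x)\<bar> \<le> B"
    using f by (auto simp: bounded_on_def)
  have "\<bar>L (\<lambda>x. f (y, x))\<bar> \<le> B" if y: "y \<in> Y" for y
  proof -
    have b: "bounded_on X (\<lambda>x. f (y, x))" using B[OF y] by (rule bounded_onI)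
    have "L (\<lambda>x. f (y, x)) \<le> L (\<lambda>_. B)" "L (\<lambda>_. - B) \<le> L (\<lambda>x. f (y, x))"
      by (intro mono b bounded_on_intros; use B[OF y] in \<open>force simp: abs_le_iff\<close>)+
    then show ?thesis by (simp add: const)
  qed
  then show ?thesis by (rule bounded_onI)
qed

text \<open>Iterated integration. Means do not satisfy Fubini's theorem in general, so the order matters;
  the result is a mean in either order.\<close>

lemma mean_product:
  assumes "mean X L" "mean Y M"
  shows "mean (X \<times> Y) (\<lambda>f. L (\<lambda>x. M (\<lambda>y. f (x, y))))"
proof -
  interpret L: mean X L by fact
  interpret M: mean Y M by fact
  have sec: "bounded_on Y (\<lambda>y. f (x, y))" if "bounded_on (X \<times> Y) f" "x \<in> X" for f x
    using that by (auto simp: bounded_on_def)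
  note bd = M.bounded_on_section[of X]
  show ?thesis
  proof
    fix f g c assume f: "bounded_on (X \<times> Y) f" and g: "bounded_on (X \<times> Y) g"
    have "L (\<lambda>x. M (\<lambda>y. f (x, y) + g (x, y))) = L (\<lambda>x. M (\<lambda>y. f (x, y)) + M (\<lambda>y. g (x, y)))"
      using bd[of "\<lambda>p. f p + g p"] f g by (intro L.cong M.add sec) auto
    also have "\<dots> = L (\<lambda>x. M (\<lambda>y. f (x, y))) + L (\<lambda>x. M (\<lambda>y. g (x, y)))"
      using bd f g by (intro L.add) auto
    finally show "L (\<lambda>x. M (\<lambda>y. f (x, y) + g (x, y))) = \<dots>" .
    show "L (\<lambda>x. M (\<lambda>y. f (x, y))) \<le> L (\<lambda>x. M (\<lambda>y. g (x, y)))" if "\<And>p. p \<in> X \<times> Y \<Longrightarrow> f p \<le> g p"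
      using bd f g that by (intro L.mono M.mono sec) auto
  next
    fix f and c :: real assume f: "bounded_on (X \<times> Y) f"
    have "L (\<lambda>x. M (\<lambda>y. c * f (x, y))) = L (\<lambda>x. c * M (\<lambda>y. f (x, y)))"
      using bd[of "\<lambda>p. c * f p"] f by (intro L.cong M.scale sec) auto
    also have "\<dots> = c * L (\<lambda>x. M (\<lambda>y. f (x, y)))"
      using bd f by (intro L.scale) auto
    finally show "L (\<lambda>x. M (\<lambda>y. c * f (x, y))) = \<dots>" .
  qed (simp add: L.one M.one)
qed

section \<open>Ultrafilter limits and invariant means\<close>

text \<open>A filter that is minimal among the proper filters below \<open>F\<close> decides every predicate, since
  otherwise it could be refined further.\<close>

lemma ultrafilter_below:
  fixes F :: "'i filter"
  assumes "F \<noteq> bot"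
  obtains U where "U \<noteq> bot" "U \<le> F" "\<And>P. eventually P U \<or> eventually (\<lambda>x. \<not> P x) U"
proof -
  define \<A> where "\<A> = {U. U \<le> F \<and> U \<noteq> bot}"
  let ?P = "\<lambda>U V :: 'i filter. V \<le> U"
  have "\<exists>m\<in>\<A>. \<forall>a\<in>\<A>. a \<le> m \<longrightarrow> a = m"
  proof (rule predicate_Zorn)
    show "partial_order_on \<A> (relation_of ?P \<A>)"
      by (auto simp: relation_of_def partial_order_on_def preorder_on_def refl_on_def trans_def antisym_def)
    fix C assume C: "C \<in> Chains (relation_of ?P \<A>)"
    then have CA: "C \<subseteq> \<A>" and tot: "\<And>a b. a \<in> C \<Longrightarrow> b \<in> C \<Longrightarrow> a \<le> b \<or> b \<le> a"
      by (auto simp: Chains_def relation_of_def)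
    show "\<exists>u\<in>\<A>. \<forall>a\<in>C. u \<le> a"
    proof (cases "C = {}")
      case True
      then show ?thesis using assms by (auto simp: \<A>_def)
    next
      case False
      have "eventually (\<lambda>_. False) (Inf C) \<longleftrightarrow> (\<exists>b\<in>C. eventually (\<lambda>_. False) b)"
        by (rule eventually_Inf_base[OF False]) (metis tot inf.absorb1 inf.absorb2 order_refl)
      then have "Inf C \<noteq> bot" using CA by (auto simp: \<A>_def trivial_limit_def)
      moreover have "Inf C \<le> F"
      proof -
        obtain V where "V \<in> C" using False by blast
        moreover have "V \<le> F" using CA \<open>V \<in> C\<close> by (auto simp: \<A>_def)
        ultimately show ?thesis by (rule Inf_lower2)
      qed
      ultimately show ?thesis by (auto simp: \<A>_def Inf_lower intro!: bexI[of _ "Inf C"])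
    qed
  qed
  then obtain U where U: "U \<le> F" "U \<noteq> bot" "\<And>V. V \<in> \<A> \<Longrightarrow> V \<le> U \<Longrightarrow> V = U"
    by (auto simp: \<A>_def)
  have "eventually P U \<or> eventually (\<lambda>x. \<not> P x) U" for P
  proof (rule ccontr)
    assume H: "\<not> ?thesis"
    have "inf U (principal {x. P x}) \<noteq> bot"
      using H by (auto simp: trivial_limit_def eventually_inf_principal)
    then have "inf U (principal {x. P x}) = U" using U by (auto simp: \<A>_def le_infI1)
    moreover have "eventually P (inf U (principal {x. P x}))"
      by (simp add: eventually_inf_principal)
    ultimately have "eventually P U" by (simp only:)
    then show False using H by blast
  qed
  then show ?thesis using that U by blast
qed

lemma ultrafilter_tendsto:
  fixes f :: "'i \<Rightarrow> real"
  assumes U: "U \<noteq> bot" "\<And>P. eventually P U \<or> eventually (\<lambda>x. \<not> P x) U"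
    and f: "eventually (\<lambda>x. \<bar>f x\<bar> \<le> B) U"
  shows "(f \<longlongrightarrow> Lim U f) U"
proof -
  have "filtermap f U \<noteq> bot" using U(1) by (simp add: filtermap_bot_iff)
  moreover have "eventually (\<lambda>y. y \<in> {-B..B}) (filtermap f U)"
    using f by (simp add: eventually_filtermap abs_le_iff minus_le_iff conj_commute)
  ultimately obtain l where l: "inf (nhds l) (filtermap f U) \<noteq> bot"
    using compact_Icc[of "-B" B] unfolding compact_filter by blast
  have "(f \<longlongrightarrow> l) U"
  proof (rule topological_tendstoI, rule ccontr)
    fix S assume S: "open S" "l \<in> S" "\<not> eventually (\<lambda>x. f x \<in> S) U"
    then have "eventually (\<lambda>y. y \<notin> S) (filtermap f U)"
      using U(2) by (auto simp: eventually_filtermap)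
    moreover have "eventually (\<lambda>y. y \<in> S) (nhds l)" using S by (simp add: eventually_nhds) blast
    ultimately have "eventually (\<lambda>_. False) (inf (nhds l) (filtermap f U))"
      unfolding eventually_inf by blast
    then show False using l by (simp add: trivial_limit_def)
  qed
  then show ?thesis using tendsto_Lim[of U f l] U(1) by simp
qed

text \<open>Right translation changes neither the cardinality nor the size of \<open>k F - F\<close> for a finite set \<open>F\<close>. So a
  Folner set \<open>F\<close> may be replaced by \<open>F y\<inverse>\<close>, where \<open>y\<close> almost attains the supremum in
  \<open>sigma_R\<close>, and then it meets \<open>A\<close> itself in the required proportion.\<close>

lemma amenable_Folner_density:
  fixes G :: "('a, 'm) monoid_scheme" and \<epsilon> \<delta> :: real
  assumes am: "amenable_group G" and K: "finite K" "K \<subseteq> carrier G" and \<epsilon>: "\<epsilon> > 0"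
    and A: "A \<subseteq> carrier G" and \<delta>: "\<delta> < sigma_R G A"
  shows "\<exists>E. finite E \<and> E \<noteq> {} \<and> E \<subseteq> carrier G \<and>
    (\<forall>k\<in>K. real (card ((k <#\<^bsub>G\<^esub> E) - E)) \<le> \<epsilon> * card E) \<and> \<delta> * card E \<le> card (E \<inter> A)"
proof -
  have "group G" using am by (simp add: amenable_group_def)
  then interpret group G .
  obtain F where F: "finite F" "F \<noteq> {}" "F \<subseteq> carrier G"
    "\<And>k. k \<in> K \<Longrightarrow> real (card ((k <#\<^bsub>G\<^esub> F) - F)) \<le> \<epsilon> * card F"
    using amenable_Folner[OF am K \<epsilon>] by blast
  define q where "q F y = real (card (F \<inter> (A #>\<^bsub>G\<^esub> y))) / real (card F)" for F y
  have q: "0 \<le> q F y" "q F y \<le> 1" if "finite F" for F y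
    using that card_mono[of F "F \<inter> (A #>\<^bsub>G\<^esub> y)"] by (auto simp: q_def divide_le_eq_1)
  have sup: "0 \<le> (SUP y\<in>carrier G. q F y)" if "finite F" for F
    using q[OF that] by (intro cSUP_upper2[of _ _ "\<one>\<^bsub>G\<^esub>"] bdd_aboveI2[of _ _ 1]) auto
  have "sigma_R G A \<le> (SUP y\<in>carrier G. q F y)"
    unfolding sigma_R_def q_def[symmetric]
    using F sup by (intro cINF_lower bdd_belowI2[of _ 0]) auto
  then have "\<delta> < (SUP y\<in>carrier G. q F y)" using \<delta> by simp
  then obtain y where y: "y \<in> carrier G" "\<delta> < q F y"
    using less_cSUP_iff[of "carrier G" "q F" \<delta>] q[OF F(1)] by (fastforce intro: bdd_aboveI2[of _ _ 1])
  let ?z = "inv\<^bsub>G\<^esub> y"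
  let ?r = "\<lambda>x. x \<otimes>\<^bsub>G\<^esub> ?z"
  have z: "?z \<in> carrier G" using y by simp
  have inj: "inj_on ?r (carrier G)" using z by (simp add: inj_on_def)
  define E where "E = ?r ` F"
  have cardE: "card E = card F" unfolding E_def using inj F(3) by (intro card_image) (rule inj_on_subset)
  have "real (card ((k <#\<^bsub>G\<^esub> E) - E)) \<le> \<epsilon> * card E" if k: "k \<in> K" for k
  proof -
    have kc: "k \<in> carrier G" using k K by auto
    have "(k <#\<^bsub>G\<^esub> E) = ?r ` (k <#\<^bsub>G\<^esub> F)"
      using kc F(3) z by (force simp: E_def l_coset_def m_assoc image_iff)
    then have "(k <#\<^bsub>G\<^esub> E) - E = ?r ` ((k <#\<^bsub>G\<^esub> F) - F)"
      using inj_on_image_set_diff[OF inj, of "k <#\<^bsub>G\<^esub> F" F] l_coset_subset_G[OF F(3) kc] F(3)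
      by (auto simp: E_def)
    then have "card ((k <#\<^bsub>G\<^esub> E) - E) \<le> card ((k <#\<^bsub>G\<^esub> F) - F)"
      using F(1) by (simp add: card_image_le l_coset_def)
    then show ?thesis using F(4)[OF k] by (simp add: cardE)
  qed
  moreover have "\<delta> * card E \<le> card (E \<inter> A)"
  proof -
    have "?r ` (F \<inter> (A #>\<^bsub>G\<^esub> y)) \<subseteq> E \<inter> A"
      using A y(1) by (auto simp: E_def r_coset_def m_assoc subset_iff)
    then have "card (?r ` (F \<inter> (A #>\<^bsub>G\<^esub> y))) \<le> card (E \<inter> A)"
      using F(1) by (intro card_mono) (auto simp: E_def)
    moreover have "card (?r ` (F \<inter> (A #>\<^bsub>G\<^esub> y))) = card (F \<inter> (A #>\<^bsub>G\<^esub> y))"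
      using inj F(3) by (intro card_image) (auto intro: inj_on_subset)
    moreover have "card F > 0" using F by (simp add: card_gt_0_iff)
    ultimately show ?thesis using y(2) by (simp add: q_def cardE field_simps)
  qed
  moreover have "finite E" "E \<noteq> {}" "E \<subseteq> carrier G" using F z by (auto simp: E_def)
  ultimately show ?thesis by blast
qed

text \<open>The limit of the averages over the sets of the previous lemma, along an ultrafilter that
  eventually satisfies every Folner condition. Left invariance holds because the sums of \<open>f\<close> over
  \<open>E\<close> and over \<open>k E\<close> differ only on their symmetric difference.\<close>

theorem invariant_mean_positive:
  fixes G :: "('a, 'm) monoid_scheme"
  assumes am: "amenable_group G" and A: "A \<subseteq> carrier G" and pos: "sigma_R G A > 0"
  obtains L where "mean (carrier G) L" "0 < L (indicator A)"
    "\<And>k f. k \<in> carrier G \<Longrightarrow> bounded_on (carrier G) f \<Longrightarrow> L (\<lambda>x. f (k \<otimes>\<^bsub>G\<^esub> x)) = L f"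
proof -
  have "group G" using am by (simp add: amenable_group_def)
  then interpret group G .
  define \<delta> where "\<delta> = sigma_R G A / 2"
  have \<delta>: "0 < \<delta>" "\<delta> < sigma_R G A" using pos by (simp_all add: \<delta>_def)
  define good where "good K n = {E. finite E \<and> E \<noteq> {} \<and> E \<subseteq> carrier G \<and>
    (\<forall>k\<in>K. real (card ((k <#\<^bsub>G\<^esub> E) - E)) \<le> inverse (real (Suc n)) * card E) \<and> \<delta> * card E \<le> card (E \<inter> A)}"
    for K n
  define I where "I = {K. finite K \<and> K \<subseteq> carrier G} \<times> (UNIV :: nat set)"
  \<comment> \<open>Finitely many of the sets \<open>good K n\<close> contain a common one, so they generate a proper filter.\<close>
  define F where "F = (INF (K, n)\<in>I. principal (good K n))"
  have base: "eventually P F \<longleftrightarrow> (\<exists>p\<in>I. eventually P (principal (good (fst p) (snd p))))" for P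
    unfolding F_def case_prod_beta
  proof (rule eventually_INF_base)
    show "I \<noteq> {}" by (auto simp: I_def)
    fix a b assume ab: "a \<in> I" "b \<in> I"
    have le: "inverse (real (Suc n)) * c \<le> inverse (real (Suc m)) * c" if "m \<le> n" "c \<ge> 0" for n m c
      using that by (intro mult_right_mono le_imp_inverse_le) auto
    have mono: "good (fst a \<union> fst b) (max (snd a) (snd b)) \<subseteq> good (fst p) (snd p)" if "p = a \<or> p = b" for p
    proof
      fix E assume E: "E \<in> good (fst a \<union> fst b) (max (snd a) (snd b))"
      have "real (card ((k <#\<^bsub>G\<^esub> E) - E)) \<le> inverse (real (Suc (snd p))) * card E" if "k \<in> fst p" for k
      proof -
        have "real (card ((k <#\<^bsub>G\<^esub> E) - E)) \<le> inverse (real (Suc (max (snd a) (snd b)))) * card E"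
          using E that \<open>p = a \<or> p = b\<close> by (auto simp: good_def)
        also have "\<dots> \<le> inverse (real (Suc (snd p))) * card E"
          using \<open>p = a \<or> p = b\<close> by (intro le) auto
        finally show ?thesis .
      qed
      then show "E \<in> good (fst p) (snd p)" using E by (simp add: good_def)
    qed
    show "\<exists>x\<in>I. principal (good (fst x) (snd x))
        \<le> inf (principal (good (fst a) (snd a))) (principal (good (fst b) (snd b)))"
      using ab mono[of a] mono[of b]
      by (intro bexI[of _ "(fst a \<union> fst b, max (snd a) (snd b))"]) (auto simp: I_def)
  qed
  have "good K n \<noteq> {}" if "finite K" "K \<subseteq> carrier G" for K n
    using amenable_Folner_density[OF am that _ A \<delta>(2), of "inverse (real (Suc n))"]
    unfolding good_def by auto
  then have "good (fst p) (snd p) \<noteq> {}" if "p \<in> I" for p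
    using that by (auto simp: I_def)
  then have "\<not> eventually (\<lambda>_. False) F"
    unfolding base eventually_principal by blast
  then have "F \<noteq> bot" by (simp add: trivial_limit_def)
  then obtain U where U: "U \<noteq> bot" "U \<le> F" and ultra: "\<And>P. eventually P U \<or> eventually (\<lambda>x. \<not> P x) U"
    using ultrafilter_below by blast
  have ev: "eventually (\<lambda>E. E \<in> good K n) U" if "finite K" "K \<subseteq> carrier G" for K n
  proof -
    have "F \<le> principal (good K n)"
      unfolding F_def by (rule INF_lower2[of "(K, n)"]) (use that in \<open>auto simp: I_def\<close>)
    then show ?thesis using U(2) by (simp add: le_principal eventually_mono filter_leD)
  qed
  define avg where "avg f E = (\<Sum>x\<in>E. f x) / real (card E)" for f :: "'a \<Rightarrow> real" and E
  define L where "L f = Lim U (avg f)" for f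
  have lim: "(avg f \<longlongrightarrow> L f) U" if "bounded_on (carrier G) f" for f
  proof -
    obtain B where B: "\<And>x. x \<in> carrier G \<Longrightarrow> \<bar>f x\<bar> \<le> B"
      using \<open>bounded_on (carrier G) f\<close> by (auto simp: bounded_on_def)
    have "\<bar>avg f E\<bar> \<le> B" if E: "E \<in> good {} 0" for E
    proof -
      have "\<bar>\<Sum>x\<in>E. f x\<bar> \<le> (\<Sum>x\<in>E. \<bar>f x\<bar>)" by (rule sum_abs)
      also have "\<dots> \<le> (\<Sum>x\<in>E. B)" using E B by (intro sum_mono) (auto simp: good_def)
      finally show ?thesis
        using E by (simp add: avg_def good_def card_gt_0_iff divide_le_eq mult.commute)
    qed
    then have "eventually (\<lambda>E. \<bar>avg f E\<bar> \<le> B) U"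
      using ev[of "{}" 0] by (auto elim: eventually_mono)
    then show ?thesis unfolding L_def by (rule ultrafilter_tendsto[OF U(1) ultra])
  qed
  have uniq: "L f = l" if "(avg f \<longlongrightarrow> l) U" for f l
    unfolding L_def using tendsto_Lim[OF U(1) that] .
  have m: "mean (carrier G) L"
  proof
    fix f g c assume f: "bounded_on (carrier G) f" and g: "bounded_on (carrier G) g"
    have "avg (\<lambda>x. f x + g x) = (\<lambda>E. avg f E + avg g E)"
      by (auto simp: avg_def sum.distrib add_divide_distrib)
    then show "L (\<lambda>x. f x + g x) = L f + L g"
      using tendsto_add[OF lim[OF f] lim[OF g]] by (intro uniq) simp
    assume le: "\<And>x. x \<in> carrier G \<Longrightarrow> f x \<le> g x"
    have "avg f E \<le> avg g E" if "E \<in> good {} 0" for E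
      using that le by (auto simp: avg_def good_def intro!: divide_right_mono sum_mono)
    then have "eventually (\<lambda>E. avg f E \<le> avg g E) U"
      using ev[of "{}" 0] by (auto elim: eventually_mono)
    then show "L f \<le> L g" by (rule tendsto_le[OF U(1) lim[OF g] lim[OF f]])
  next
    fix f and c :: real assume f: "bounded_on (carrier G) f"
    have "avg (\<lambda>x. c * f x) = (\<lambda>E. c * avg f E)"
      by (auto simp: avg_def sum_distrib_left)
    then show "L (\<lambda>x. c * f x) = c * L f"
      using tendsto_mult_left[OF lim[OF f]] by (intro uniq) simp
  next
    have "avg (\<lambda>_. 1) E = 1" if "E \<in> good {} 0" for E
      using that by (auto simp: avg_def good_def)
    then have "eventually (\<lambda>E. avg (\<lambda>_. 1) E = 1) U"
      using ev[of "{}" 0] by (auto elim: eventually_mono)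
    then show "L (\<lambda>_. 1) = 1" by (intro uniq tendsto_eventually)
  qed
  have "\<delta> \<le> avg (indicator A) E" if "E \<in> good {} 0" for E
    using that
    by (simp add: avg_def good_def indicator_def sum_of_bool_eq card_gt_0_iff le_divide_eq)
  then have "eventually (\<lambda>E. \<delta> \<le> avg (indicator A) E) U"
    using ev[of "{}" 0] by (auto elim: eventually_mono)
  then have "\<delta> \<le> L (indicator A)"
    using tendsto_lowerbound[OF lim _ U(1)] bounded_onI[of "carrier G" "indicator A" 1]
    by (auto simp: indicator_def)
  moreover have "L (\<lambda>x. f (k \<otimes>\<^bsub>G\<^esub> x)) = L f" if k: "k \<in> carrier G" and f: "bounded_on (carrier G) f" for k f
  proof -
    obtain B where B: "\<And>x. x \<in> carrier G \<Longrightarrow> \<bar>f x\<bar> \<le> B"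
      using f by (auto simp: bounded_on_def)
    have B0: "0 \<le> B" using B[OF one_closed] by simp
    let ?fk = "\<lambda>x. f (k \<otimes>\<^bsub>G\<^esub> x)"
    have fk: "bounded_on (carrier G) ?fk" using k B by (intro bounded_onI) auto
    have close: "\<bar>avg ?fk E - avg f E\<bar> \<le> 2 * B * inverse (real (Suc n))" if E: "E \<in> good {k} n" for E n
    proof -
      have E': "finite E" "E \<noteq> {}" "E \<subseteq> carrier G"
        "real (card ((k <#\<^bsub>G\<^esub> E) - E)) \<le> inverse (real (Suc n)) * card E"
        using E by (auto simp: good_def)
      have inj: "inj_on (\<lambda>x. k \<otimes>\<^bsub>G\<^esub> x) E" using k E'(3) by (intro inj_onI) (metis in_mono Units_l_cancel Units_eq)
      have kE: "k <#\<^bsub>G\<^esub> E = (\<lambda>x. k \<otimes>\<^bsub>G\<^esub> x) ` E" by (auto simp: l_coset_def)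
      have fin: "finite (k <#\<^bsub>G\<^esub> E)" and sub: "k <#\<^bsub>G\<^esub> E \<subseteq> carrier G"
        using E' k by (auto simp: kE)
      have card_eq: "card (k <#\<^bsub>G\<^esub> E) = card E" unfolding kE by (rule card_image[OF inj])
      have card_diff: "card (E - (k <#\<^bsub>G\<^esub> E)) = card ((k <#\<^bsub>G\<^esub> E) - E)"
        using card_Diff_subset_Int[of E "k <#\<^bsub>G\<^esub> E"] card_Diff_subset_Int[of "k <#\<^bsub>G\<^esub> E" E] fin E'(1) card_eq
        by (simp add: Int_commute)
      have bd: "\<bar>\<Sum>x\<in>S. f x\<bar> \<le> B * card S" if "S \<subseteq> carrier G" for S
      proof -
        have "\<bar>\<Sum>x\<in>S. f x\<bar> \<le> (\<Sum>x\<in>S. \<bar>f x\<bar>)" by (rule sum_abs)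
        also have "\<dots> \<le> (\<Sum>x\<in>S. B)" using that B by (intro sum_mono) auto
        finally show ?thesis by (simp add: mult.commute)
      qed
      have "(\<Sum>x\<in>E. ?fk x) = (\<Sum>x\<in>k <#\<^bsub>G\<^esub> E. f x)"
        unfolding kE by (simp add: sum.reindex[OF inj])
      also have "\<dots> = (\<Sum>x\<in>(k <#\<^bsub>G\<^esub> E) - E. f x) + (\<Sum>x\<in>(k <#\<^bsub>G\<^esub> E) \<inter> E. f x)"
        using sum.Int_Diff[OF fin, of f E] by simp
      finally have 1: "(\<Sum>x\<in>E. ?fk x) - (\<Sum>x\<in>E. f x)
          = (\<Sum>x\<in>(k <#\<^bsub>G\<^esub> E) - E. f x) - (\<Sum>x\<in>E - (k <#\<^bsub>G\<^esub> E). f x)"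
        using sum.Int_Diff[OF E'(1), of f "k <#\<^bsub>G\<^esub> E"] by (simp add: Int_commute)
      have "\<bar>\<Sum>x\<in>(k <#\<^bsub>G\<^esub> E) - E. f x\<bar> \<le> B * card ((k <#\<^bsub>G\<^esub> E) - E)"
        "\<bar>\<Sum>x\<in>E - (k <#\<^bsub>G\<^esub> E). f x\<bar> \<le> B * card ((k <#\<^bsub>G\<^esub> E) - E)"
        using bd[of "(k <#\<^bsub>G\<^esub> E) - E"] bd[of "E - (k <#\<^bsub>G\<^esub> E)"] sub E'(3) card_diff by auto
      with 1 have "\<bar>(\<Sum>x\<in>E. ?fk x) - (\<Sum>x\<in>E. f x)\<bar> \<le> 2 * (B * card ((k <#\<^bsub>G\<^esub> E) - E))"
        by linarith
      also have "\<dots> \<le> 2 * (B * (inverse (real (Suc n)) * card E))"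
        using E'(4) B0 by (intro mult_left_mono) auto
      finally have "\<bar>(\<Sum>x\<in>E. ?fk x) - (\<Sum>x\<in>E. f x)\<bar> / card E \<le> 2 * B * inverse (real (Suc n))"
        using E' by (simp add: card_gt_0_iff divide_le_eq mult.assoc)
      then show ?thesis by (simp add: avg_def diff_divide_distrib[symmetric])
    qed
    have "((\<lambda>E. \<bar>avg ?fk E - avg f E\<bar>) \<longlongrightarrow> \<bar>L ?fk - L f\<bar>) U"
      by (intro tendsto_intros lim f fk)
    then have "\<bar>L ?fk - L f\<bar> \<le> 2 * B * inverse (real (Suc n))" for n
      by (rule tendsto_upperbound[OF _ _ U(1)]) (use ev[of "{k}" n] k close in \<open>auto elim: eventually_mono\<close>)
    moreover have "(\<lambda>n. 2 * B * inverse (real (Suc n))) \<longlonglongrightarrow> 2 * B * 0"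
      by (intro tendsto_intros LIMSEQ_inverse_real_of_nat)
    ultimately have "\<bar>L ?fk - L f\<bar> \<le> 2 * B * 0"
      by (intro LIMSEQ_le_const) auto
    then show ?thesis by simp
  qed
  ultimately show ?thesis using that[of L] m \<delta>(1) by force
qed

section \<open>Families of functions with finite oscillation\<close>

text \<open>For bounded functions this says, when it holds for every \<open>\<epsilon> > 0\<close>, that the functions
  \<open>\<lambda>y. F y g\<close> with \<open>g \<in> S\<close> form a totally bounded set in the supremum norm over \<open>Y\<close>.\<close>

definition finite_oscillation :: "real \<Rightarrow> 'a set \<Rightarrow> 'x set \<Rightarrow> ('x \<Rightarrow> 'a \<Rightarrow> real) \<Rightarrow> bool" where
  "finite_oscillation \<epsilon> S Y F \<longleftrightarrow> (\<exists>\<P>. finite \<P> \<and> S \<subseteq> \<Union>\<P> \<and>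
     (\<forall>P\<in>\<P>. \<forall>g\<in>P \<inter> S. \<forall>h\<in>P \<inter> S. \<forall>y\<in>Y. \<bar>F y g - F y h\<bar> \<le> \<epsilon>))"

lemma finite_oscillationI:
  assumes "finite \<P>" "S \<subseteq> \<Union>\<P>"
    "\<And>P g h y. P \<in> \<P> \<Longrightarrow> g \<in> P \<inter> S \<Longrightarrow> h \<in> P \<inter> S \<Longrightarrow> y \<in> Y \<Longrightarrow> \<bar>F y g - F y h\<bar> \<le> \<epsilon>"
  shows "finite_oscillation \<epsilon> S Y F"
  unfolding finite_oscillation_def using assms by (intro exI[of _ \<P>] conjI ballI)

lemma finite_oscillationE:
  assumes "finite_oscillation \<epsilon> S Y F"
  obtains \<P> where "finite \<P>" "S \<subseteq> \<Union>\<P>"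
    "\<And>P g h y. P \<in> \<P> \<Longrightarrow> g \<in> P \<inter> S \<Longrightarrow> h \<in> P \<inter> S \<Longrightarrow> y \<in> Y \<Longrightarrow> \<bar>F y g - F y h\<bar> \<le> \<epsilon>"
proof -
  obtain \<P> where P: "finite \<P>" "S \<subseteq> \<Union>\<P>"
    "\<forall>P\<in>\<P>. \<forall>g\<in>P \<inter> S. \<forall>h\<in>P \<inter> S. \<forall>y\<in>Y. \<bar>F y g - F y h\<bar> \<le> \<epsilon>"
    using assms unfolding finite_oscillation_def by (elim exE conjE)
  show ?thesis by (rule that[OF P(1,2)]) (use P(3) in simp)
qed

lemma finite_oscillation_midpoint:
  assumes "finite_oscillation \<epsilon> S Y F" "finite_oscillation \<epsilon> S Y F'"
  shows "finite_oscillation \<epsilon> S Y (\<lambda>y g. (F y g + F' y g) / 2)"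
proof -
  obtain \<P> where P: "finite \<P>" "S \<subseteq> \<Union>\<P>"
    "\<And>P g h y. P \<in> \<P> \<Longrightarrow> g \<in> P \<inter> S \<Longrightarrow> h \<in> P \<inter> S \<Longrightarrow> y \<in> Y \<Longrightarrow> \<bar>F y g - F y h\<bar> \<le> \<epsilon>"
    by (rule finite_oscillationE[OF assms(1)]) (rule that)
  obtain \<Q> where Q: "finite \<Q>" "S \<subseteq> \<Union>\<Q>"
    "\<And>P g h y. P \<in> \<Q> \<Longrightarrow> g \<in> P \<inter> S \<Longrightarrow> h \<in> P \<inter> S \<Longrightarrow> y \<in> Y \<Longrightarrow> \<bar>F' y g - F' y h\<bar> \<le> \<epsilon>"
    by (rule finite_oscillationE[OF assms(2)]) (rule that)
  show ?thesis
  proof (rule finite_oscillationI)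
    show "finite ((\<lambda>(P, Q). P \<inter> Q) ` (\<P> \<times> \<Q>))" using P(1) Q(1) by simp
    show "S \<subseteq> \<Union>((\<lambda>(P, Q). P \<inter> Q) ` (\<P> \<times> \<Q>))" using P(2) Q(2) by fastforce
    fix R g h y
    assume "R \<in> (\<lambda>(P, Q). P \<inter> Q) ` (\<P> \<times> \<Q>)" and gh: "g \<in> R \<inter> S" "h \<in> R \<inter> S" and y: "y \<in> Y"
    then obtain P' Q' where R: "P' \<in> \<P>" "Q' \<in> \<Q>" "R = P' \<inter> Q'" by auto
    have FF: "\<bar>F y g - F y h\<bar> \<le> \<epsilon>" "\<bar>F' y g - F' y h\<bar> \<le> \<epsilon>"
      using P(3)[OF R(1) _ _ y] Q(3)[OF R(2) _ _ y] gh R(3) by simp_all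
    have "(F y g + F' y g) / 2 - (F y h + F' y h) / 2
        = ((F y g - F y h) + (F' y g - F' y h)) / 2"
      by (simp add: field_simps)
    also have "\<bar>\<dots>\<bar> \<le> (\<bar>F y g - F y h\<bar> + \<bar>F' y g - F' y h\<bar>) / 2"
      by (simp add: abs_triangle_ineq)
    also have "\<dots> \<le> \<epsilon>" using FF by simp
    finally show "\<bar>(F y g + F' y g) / 2 - (F y h + F' y h) / 2\<bar> \<le> \<epsilon>" .
  qed
qed

section \<open>The vector of least norm and its correlation function\<close>

text \<open>In the application \<open>\<alpha>\<close> and \<open>\<beta>\<close> are the indicator functions of \<open>A\<close> and \<open>B\<close>.\<close>

locale mean_pair = group G + L: mean "carrier G" L + M: mean "carrier G" M
  for G (structure) and L M :: "('a \<Rightarrow> real) \<Rightarrow> real" +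
  fixes \<alpha> \<beta> :: "'a \<Rightarrow> real"
  assumes L_inv: "k \<in> carrier G \<Longrightarrow> bounded_on (carrier G) f \<Longrightarrow> L (\<lambda>x. f (k \<otimes> x)) = L f"
    and M_inv: "k \<in> carrier G \<Longrightarrow> bounded_on (carrier G) f \<Longrightarrow> M (\<lambda>x. f (k \<otimes> x)) = M f"
    and \<alpha>: "x \<in> carrier G \<Longrightarrow> 0 \<le> \<alpha> x \<and> \<alpha> x \<le> 1"
    and \<beta>: "x \<in> carrier G \<Longrightarrow> 0 \<le> \<beta> x \<and> \<beta> x \<le> 1"
    and L_pos: "0 < L \<alpha>" and M_pos: "0 < M \<beta>"
begin

abbreviation "X \<equiv> carrier G \<times> carrier G"

definition J :: "('a \<times> 'a \<Rightarrow> real) \<Rightarrow> real" where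
  "J f = L (\<lambda>x. M (\<lambda>y. f (x, y)))"

sublocale J: mean X J
  unfolding J_def by (rule mean_product) unfold_locales

definition shift :: "'a \<Rightarrow> 'a \<times> 'a \<Rightarrow> 'a \<times> 'a" where
  "shift k p = (k \<otimes> fst p, k \<otimes> snd p)"

text \<open>The translate of \<open>\<alpha>\<close> by \<open>a\<close> in the first variable times the translate of \<open>\<beta>\<close> by \<open>b\<close> in the second:
  the indicator function of \<open>aA \<times> bB\<close> when \<open>\<alpha>\<close> and \<open>\<beta>\<close> are those of \<open>A\<close> and \<open>B\<close>.\<close>

definition e :: "'a \<Rightarrow> 'a \<Rightarrow> 'a \<times> 'a \<Rightarrow> real" where
  "e a b p = \<alpha> (inv a \<otimes> fst p) * \<beta> (inv b \<otimes> snd p)"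

text \<open>The convex combinations of the diagonal translates \<open>e h h\<close> with dyadic coefficients. The
  parallelogram law only needs midpoints, and this set carries an induction principle that makes
  finite sums unnecessary.\<close>

inductive_set midpoints :: "('a \<times> 'a \<Rightarrow> real) set" where
  base: "h \<in> carrier G \<Longrightarrow> e h h \<in> midpoints"
| mid: "f \<in> midpoints \<Longrightarrow> g \<in> midpoints \<Longrightarrow> (\<lambda>p. (f p + g p) / 2) \<in> midpoints"

definition unit_valued :: "('a \<times> 'a \<Rightarrow> real) \<Rightarrow> bool" where
  "unit_valued f \<longleftrightarrow> (\<forall>p\<in>X. 0 \<le> f p \<and> f p \<le> 1)"

lemma unit_valued_bounded: "unit_valued f \<Longrightarrow> bounded_on X f"
  by (rule bounded_onI[of _ _ 1]) (auto simp: unit_valued_def)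

lemma unit_valued_e:
  assumes "a \<in> carrier G" "b \<in> carrier G"
  shows "unit_valued (e a b)"
  using assms \<alpha> \<beta> by (auto simp: unit_valued_def e_def mult_le_one)

lemma unit_valued_midpoints: "f \<in> midpoints \<Longrightarrow> unit_valued f"
proof (induction rule: midpoints.induct)
  case (mid f g)
  then show ?case by (fastforce simp: unit_valued_def)
qed (simp add: unit_valued_e)

lemmas bounded_e = unit_valued_bounded[OF unit_valued_e]
lemmas bounded_midpoints = unit_valued_bounded[OF unit_valued_midpoints]

lemma J_shift:
  assumes k: "k \<in> carrier G" and f: "bounded_on X f"
  shows "J (\<lambda>p. f (shift k p)) = J f"
proof -
  have sec: "bounded_on (carrier G) (\<lambda>y. f (x, y))" if "x \<in> carrier G" for x
    using f that by (auto simp: bounded_on_def)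
  have bd: "bounded_on (carrier G) (\<lambda>x. M (\<lambda>y. f (x, y)))"
    by (rule M.bounded_on_section[OF f])
  have "M (\<lambda>y. f (k \<otimes> x, k \<otimes> y)) = M (\<lambda>y. f (k \<otimes> x, y))" if "x \<in> carrier G" for x
    using M_inv[OF k sec[of "k \<otimes> x"]] k that by simp
  then have "L (\<lambda>x. M (\<lambda>y. f (k \<otimes> x, y))) = L (\<lambda>x. M (\<lambda>y. f (k \<otimes> x, k \<otimes> y)))"
    using bd k by (intro L.cong) (auto simp: bounded_on_def)
  then show ?thesis
    using L_inv[OF k bd] by (simp add: J_def shift_def)
qed

lemma J_product:
  assumes u: "bounded_on (carrier G) u" and v: "bounded_on (carrier G) v"
  shows "J (\<lambda>p. u (fst p) * v (snd p)) = L u * M v"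
proof -
  have "J (\<lambda>p. u (fst p) * v (snd p)) = L (\<lambda>x. M v * u x)"
    by (simp add: J_def M.scale[OF v] mult.commute)
  then show ?thesis by (simp add: L.scale[OF u])
qed

lemma bounded_translates:
  assumes "h \<in> carrier G"
  shows "bounded_on (carrier G) (\<lambda>x. \<alpha> (inv h \<otimes> x))" "bounded_on (carrier G) (\<lambda>x. \<beta> (inv h \<otimes> x))"
  using assms \<alpha> \<beta> by (auto intro!: bounded_onI[of _ _ 1])

lemma J_midpoints: "f \<in> midpoints \<Longrightarrow> J f = L \<alpha> * M \<beta>"
proof (induction rule: midpoints.induct)
  case (base h)
  have "bounded_on (carrier G) \<alpha>" "bounded_on (carrier G) \<beta>"
    using \<alpha> \<beta> by (auto intro!: bounded_onI[of _ _ 1])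
  then show ?case
    using J_product[OF bounded_translates[OF base]] L_inv[of "inv h" \<alpha>] M_inv[of "inv h" \<beta>] base
    by (simp add: e_def[abs_def])
next
  case (mid f g)
  have "J (\<lambda>p. (f p + g p) / 2) = J (\<lambda>p. (1/2) * (f p + g p))" by simp
  also have "\<dots> = (1/2) * (J f + J g)"
    using mid by (simp only: J.scale J.add bounded_midpoints bounded_on_intros)
  finally show ?case using mid by simp
qed

definition sq :: "('a \<times> 'a \<Rightarrow> real) \<Rightarrow> real" where
  "sq f = J (\<lambda>p. (f p)\<^sup>2)"

definition min_sq :: real where "min_sq = Inf (sq ` midpoints)"

lemma midpoints_nonempty: "midpoints \<noteq> {}"
  using midpoints.base[OF one_closed] by blast

lemma sq_lower: "f \<in> midpoints \<Longrightarrow> (L \<alpha> * M \<beta>)\<^sup>2 \<le> sq f"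
  using J.variance[OF bounded_midpoints] J_midpoints by (metis sq_def)

lemma min_sq_le: "f \<in> midpoints \<Longrightarrow> min_sq \<le> sq f"
  unfolding min_sq_def by (rule cINF_lower) (auto intro!: bdd_belowI2[OF sq_lower])

lemma min_sq_pos: "0 < min_sq"
proof -
  have "0 < (L \<alpha> * M \<beta>)\<^sup>2" using L_pos M_pos by simp
  also have "\<dots> \<le> min_sq"
    unfolding min_sq_def using midpoints_nonempty sq_lower by (intro cINF_greatest)
  finally show ?thesis .
qed

text \<open>By the parallelogram law two vectors of nearly least norm are close to each other, since
  their midpoint has norm at least the minimum: \<open>\<parallel>f - g\<parallel>\<^sup>2 = 2 \<parallel>f\<parallel>\<^sup>2 + 2 \<parallel>g\<parallel>\<^sup>2 - 4 \<parallel>(f + g) / 2\<parallel>\<^sup>2\<close>,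
  which is at most \<open>2 r\<^sup>2 + 2 s\<^sup>2\<close>. Pairing with \<open>t\<close> is continuous because \<open>\<bar>t\<bar> \<le> 1\<close>.\<close>

lemma near_minimal_close:
  assumes f: "f \<in> midpoints" "sq f \<le> min_sq + r\<^sup>2" and g: "g \<in> midpoints" "sq g \<le> min_sq + s\<^sup>2"
    and t: "unit_valued t" and rs: "0 \<le> r" "0 \<le> s"
  shows "\<bar>J (\<lambda>p. f p * t p) - J (\<lambda>p. g p * t p)\<bar> \<le> 2 * (r + s)"
proof -
  note b [simp] = bounded_midpoints[OF f(1)] bounded_midpoints[OF g(1)] unit_valued_bounded[OF t]
  have "min_sq \<le> sq (\<lambda>p. (f p + g p) / 2)" using f g by (intro min_sq_le midpoints.mid)
  moreover have "J (\<lambda>p. (f p - g p)\<^sup>2) = 2 * sq f + 2 * sq g - 4 * sq (\<lambda>p. (f p + g p) / 2)"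
  proof -
    have mid: "bounded_on X (\<lambda>p. ((f p + g p) / 2)\<^sup>2)"
      using f g by (intro bounded_on_intros bounded_midpoints midpoints.mid)
    have "(\<lambda>p. (f p - g p)\<^sup>2) = (\<lambda>p. (2 * (f p)\<^sup>2 + 2 * (g p)\<^sup>2) - 4 * ((f p + g p) / 2)\<^sup>2)"
      by (auto simp: power2_eq_square algebra_simps)
    then show ?thesis using mid by (simp add: J.diff J.add J.scale sq_def del: power_divide)
  qed
  ultimately have dist: "J (\<lambda>p. (f p - g p)\<^sup>2) \<le> 2 * r\<^sup>2 + 2 * s\<^sup>2" using f g by simp
  have "(J (\<lambda>p. f p * t p) - J (\<lambda>p. g p * t p))\<^sup>2 = (J (\<lambda>p. (f p - g p) * t p))\<^sup>2"
    by (simp add: J.diff[symmetric] algebra_simps)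
  also have "\<dots> \<le> J (\<lambda>p. ((f p - g p) * t p)\<^sup>2)"
    by (intro J.variance) simp
  also have "\<dots> \<le> J (\<lambda>p. (f p - g p)\<^sup>2)"
  proof (rule J.mono)
    fix p assume "p \<in> X"
    then have "(t p)\<^sup>2 \<le> 1" using t by (auto simp: unit_valued_def power_le_one)
    then show "((f p - g p) * t p)\<^sup>2 \<le> (f p - g p)\<^sup>2"
      by (simp add: power_mult_distrib mult_left_le)
  qed simp_all
  also have "\<dots> \<le> (2 * (r + s))\<^sup>2"
  proof -
    have "2 * r\<^sup>2 + 2 * s\<^sup>2 \<le> 4 * r\<^sup>2 + 4 * s\<^sup>2 + 8 * (r * s)"
      using rs by (simp add: mult_nonneg_nonneg add_mono)
    then show ?thesis using dist by (simp add: power2_eq_square algebra_simps)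
  qed
  finally show ?thesis using rs abs_le_square_iff[of _ "2 * (r + s)"] by simp
qed

definition rad :: "nat \<Rightarrow> real" where "rad n = inverse (real (Suc n))"

lemma rad: "0 < rad n" "rad \<longlonglongrightarrow> 0"
  unfolding rad_def using LIMSEQ_inverse_real_of_nat by simp_all

definition near_min :: "nat \<Rightarrow> 'a \<times> 'a \<Rightarrow> real" where
  "near_min n = (SOME f. f \<in> midpoints \<and> sq f \<le> min_sq + (rad n)\<^sup>2)"

lemma near_min: "near_min n \<in> midpoints" "sq (near_min n) \<le> min_sq + (rad n)\<^sup>2"
proof -
  have "min_sq < min_sq + (rad n)\<^sup>2" using rad(1)[of n] by simp
  then obtain f where "f \<in> midpoints" "sq f < min_sq + (rad n)\<^sup>2"
    using cINF_less_iff[OF midpoints_nonempty, of sq "min_sq + (rad n)\<^sup>2"] sq_lower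
    by (fastforce simp: min_sq_def intro: bdd_belowI2)
  then have "\<exists>f. f \<in> midpoints \<and> sq f \<le> min_sq + (rad n)\<^sup>2" by (auto intro: less_imp_le)
  from someI_ex[OF this] show "near_min n \<in> midpoints" "sq (near_min n) \<le> min_sq + (rad n)\<^sup>2"
    by (simp_all add: near_min_def)
qed

text \<open>Instead of the vector \<open>T\<close> of least norm, which lives in a completion, only the values
  \<open>\<langle>T, t\<rangle>\<close> are introduced. The vectors \<open>near_min n\<close> form a minimizing sequence, and by the previous
  lemma their pairings with \<open>t\<close> converge, uniformly in \<open>t\<close>.\<close>

definition pairing :: "('a \<times> 'a \<Rightarrow> real) \<Rightarrow> real" where
  "pairing t = lim (\<lambda>n. J (\<lambda>p. near_min n p * t p))"

lemma pairing_lim: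
  assumes t: "unit_valued t"
  shows "(\<lambda>n. J (\<lambda>p. near_min n p * t p)) \<longlonglongrightarrow> pairing t"
proof -
  let ?s = "\<lambda>n. J (\<lambda>p. near_min n p * t p)"
  have "Cauchy ?s"
  proof (rule metric_CauchyI)
    fix \<epsilon> :: real assume "\<epsilon> > 0"
    then have "eventually (\<lambda>n. rad n < \<epsilon> / 4) sequentially"
      using rad(2) by (intro order_tendstoD) auto
    then obtain N where N: "\<And>n. n \<ge> N \<Longrightarrow> rad n < \<epsilon> / 4" by (auto simp: eventually_sequentially)
    have "dist (?s i) (?s j) < \<epsilon>" if "i \<ge> N" "j \<ge> N" for i j
      using near_minimal_close[OF near_min[of i] near_min[of j] t] rad(1)[of i] rad(1)[of j] N[OF that(1)] N[OF that(2)]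
      by (simp add: dist_real_def)
    then show "\<exists>N. \<forall>i\<ge>N. \<forall>j\<ge>N. dist (?s i) (?s j) < \<epsilon>" by blast
  qed
  then show ?thesis unfolding pairing_def by (simp add: Cauchy_convergent_iff convergent_LIMSEQ_iff)
qed

lemma pairing_near:
  assumes t: "unit_valued t" and g: "g \<in> midpoints" "sq g \<le> min_sq + r\<^sup>2" "0 \<le> r"
  shows "\<bar>J (\<lambda>p. g p * t p) - pairing t\<bar> \<le> 2 * r"
proof -
  have "(\<lambda>n. \<bar>J (\<lambda>p. g p * t p) - J (\<lambda>p. near_min n p * t p)\<bar>) \<longlonglongrightarrow> \<bar>J (\<lambda>p. g p * t p) - pairing t\<bar>"
    by (intro tendsto_intros pairing_lim t)
  moreover have "(\<lambda>n. 2 * (r + rad n)) \<longlonglongrightarrow> 2 * (r + 0)"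
    by (intro tendsto_intros rad)
  moreover have "\<bar>J (\<lambda>p. g p * t p) - J (\<lambda>p. near_min n p * t p)\<bar> \<le> 2 * (r + rad n)" for n
    using near_minimal_close[OF g(1,2) near_min[of n] t g(3)] rad(1)[of n] by simp
  ultimately show ?thesis using LIMSEQ_le by fastforce
qed

lemma e_shift:
  assumes "k \<in> carrier G" "a \<in> carrier G" "b \<in> carrier G" "p \<in> X"
  shows "e (k \<otimes> a) (k \<otimes> b) (shift k p) = e a b p"
proof -
  have "inv (k \<otimes> z) \<otimes> (k \<otimes> x) = inv z \<otimes> x" if "z \<in> carrier G" "x \<in> carrier G" for z x
  proof -
    have "inv (k \<otimes> z) \<otimes> (k \<otimes> x) = inv z \<otimes> (inv k \<otimes> (k \<otimes> x))"
      using assms(1) that by (simp add: inv_mult_group m_assoc)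
    also have "inv k \<otimes> (k \<otimes> x) = x" using assms(1) that by (simp add: m_assoc[symmetric])
    finally show ?thesis .
  qed
  then show ?thesis using assms by (auto simp: e_def shift_def)
qed

lemma midpoints_shift:
  assumes k: "k \<in> carrier G" and f: "f \<in> midpoints"
  shows "\<exists>g\<in>midpoints. \<forall>p\<in>X. g p = f (shift k p)"
  using f
proof (induction rule: midpoints.induct)
  case (base h)
  have "e (inv k \<otimes> h) (inv k \<otimes> h) p = e h h (shift k p)" if "p \<in> X" for p
  proof -
    have "k \<otimes> (inv k \<otimes> h) = h" using k base by (simp add: m_assoc[symmetric])
    then show ?thesis using e_shift[OF k _ _ that, of "inv k \<otimes> h" "inv k \<otimes> h"] k base by simp
  qed
  then show ?case using midpoints.base[of "inv k \<otimes> h"] k base by blast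
next
  case (mid f g)
  then obtain f' g' where "f' \<in> midpoints" "g' \<in> midpoints"
    "\<forall>p\<in>X. f' p = f (shift k p)" "\<forall>p\<in>X. g' p = g (shift k p)" by blast
  then show ?case by (intro bexI[OF _ midpoints.mid[of f' g']]) auto
qed

text \<open>Translating a nearly minimal vector diagonally gives a vector of the hull with the same norm.
  It is therefore equally close to the minimizer, so the minimizer is invariant.\<close>

lemma pairing_shift:
  assumes k: "k \<in> carrier G" and ab: "a \<in> carrier G" "b \<in> carrier G"
  shows "pairing (e (k \<otimes> a) (k \<otimes> b)) = pairing (e a b)"
proof -
  have "\<bar>pairing (e (k \<otimes> a) (k \<otimes> b)) - pairing (e a b)\<bar> \<le> 4 * rad n" for n
  proof -
    obtain g where g: "g \<in> midpoints" "\<And>p. p \<in> X \<Longrightarrow> g p = near_min n (shift k p)"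
      using midpoints_shift[OF k near_min(1)[of n]] by blast
    have bd: "bounded_on X (near_min n)" by (rule bounded_midpoints[OF near_min(1)])
    have ek: "unit_valued (e (k \<otimes> a) (k \<otimes> b))" and e: "unit_valued (e a b)"
      using k ab by (simp_all add: unit_valued_e)
    have "sq g = J (\<lambda>p. (near_min n (shift k p))\<^sup>2)"
      unfolding sq_def using g bounded_midpoints[OF g(1)] by (intro J.cong) auto
    also have "\<dots> = sq (near_min n)"
      unfolding sq_def using J_shift[OF k, of "\<lambda>p. (near_min n p)\<^sup>2"] bd by simp
    finally have "sq g \<le> min_sq + (rad n)\<^sup>2" using near_min(2) by simp
    then have 1: "\<bar>J (\<lambda>p. g p * e a b p) - pairing (e a b)\<bar> \<le> 2 * rad n"
      using pairing_near[OF e g(1)] rad(1)[of n] by simp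
    have "J (\<lambda>p. g p * e a b p) = J (\<lambda>p. near_min n (shift k p) * e (k \<otimes> a) (k \<otimes> b) (shift k p))"
      using g bounded_midpoints[OF g(1)] unit_valued_bounded[OF e] k ab
      by (intro J.cong) (auto simp: e_shift simp del: split_paired_All)
    also have "\<dots> = J (\<lambda>p. near_min n p * e (k \<otimes> a) (k \<otimes> b) p)"
      using J_shift[OF k, of "\<lambda>p. near_min n p * e (k \<otimes> a) (k \<otimes> b) p"] bd unit_valued_bounded[OF ek] by simp
    finally show ?thesis
      using 1 pairing_near[OF ek near_min[of n]] rad(1)[of n] by simp
  qed
  moreover have "(\<lambda>n. 4 * rad n) \<longlonglongrightarrow> 4 * 0" by (intro tendsto_intros rad)
  ultimately have "\<bar>pairing (e (k \<otimes> a) (k \<otimes> b)) - pairing (e a b)\<bar> \<le> 4 * 0"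
    by (intro LIMSEQ_le_const[of "\<lambda>n. 4 * rad n"]) auto
  then show ?thesis by simp
qed

lemma J_mid:
  assumes "bounded_on X f" "bounded_on X g" "bounded_on X t"
  shows "J (\<lambda>p. (f p + g p) / 2 * t p) = (J (\<lambda>p. f p * t p) + J (\<lambda>p. g p * t p)) / 2"
proof -
  have "J (\<lambda>p. (f p + g p) / 2 * t p) = J (\<lambda>p. (1/2) * (f p * t p + g p * t p))"
    by (simp add: ring_distribs add_divide_distrib)
  also have "\<dots> = (1/2) * (J (\<lambda>p. f p * t p) + J (\<lambda>p. g p * t p))"
    using assms by (simp only: J.scale J.add bounded_on_intros)
  finally show ?thesis by simp
qed

text \<open>By invariance \<open>\<langle>T, e h h\<rangle>\<close> does not depend on \<open>h\<close>, and by linearity it is constant on the hull.\<close>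

lemma pairing_midpoints: "f \<in> midpoints \<Longrightarrow> pairing f = pairing (e \<one> \<one>)"
proof (induction rule: midpoints.induct)
  case (base h)
  then show ?case using pairing_shift[OF base one_closed one_closed] by simp
next
  case (mid f g)
  have "(\<lambda>n. (J (\<lambda>p. near_min n p * f p) + J (\<lambda>p. near_min n p * g p)) / 2) \<longlonglongrightarrow> (pairing f + pairing g) / 2"
    using mid by (intro tendsto_intros pairing_lim unit_valued_midpoints) auto
  moreover have "(J (\<lambda>p. near_min n p * f p) + J (\<lambda>p. near_min n p * g p)) / 2
      = J (\<lambda>p. near_min n p * ((f p + g p) / 2))" for n
    using J_mid[of f g "near_min n"] mid near_min by (simp add: bounded_midpoints mult.commute)
  ultimately have "(\<lambda>n. J (\<lambda>p. near_min n p * ((f p + g p) / 2))) \<longlonglongrightarrow> (pairing f + pairing g) / 2" by simp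
  then have "pairing (\<lambda>p. (f p + g p) / 2) = (pairing f + pairing g) / 2"
    using pairing_lim[OF unit_valued_midpoints[OF midpoints.mid[OF mid.hyps]]] LIMSEQ_unique by blast
  then show ?case using mid by simp
qed

definition correlation :: "'a \<Rightarrow> real" where "correlation g = pairing (e \<one> g)"

text \<open>The value at the unit equals \<open>\<langle>T, near_min n\<rangle>\<close> for every \<open>n\<close>, and it differs by at most \<open>2 * rad n\<close>
  from \<open>\<langle>near_min n, near_min n\<rangle> \<ge> min_sq\<close>.\<close>

lemma correlation_one_pos: "0 < correlation \<one>"
proof -
  have "min_sq - 2 * rad n \<le> correlation \<one>" for n
  proof -
    have "\<bar>sq (near_min n) - pairing (near_min n)\<bar> \<le> 2 * rad n"
      using pairing_near[OF unit_valued_midpoints[OF near_min(1)] near_min, of n n] rad(1)[of n]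
      by (simp add: sq_def power2_eq_square)
    then show ?thesis using min_sq_le[OF near_min(1)[of n]] pairing_midpoints[OF near_min(1)[of n]] by (simp add: correlation_def)
  qed
  moreover have "(\<lambda>n. min_sq - 2 * rad n) \<longlonglongrightarrow> min_sq - 2 * 0" by (intro tendsto_intros rad)
  ultimately have "min_sq - 2 * 0 \<le> correlation \<one>" by (intro LIMSEQ_le_const2) auto
  then show ?thesis using min_sq_pos by simp
qed

lemma J_unit:
  assumes "unit_valued f" "unit_valued g"
  shows "0 \<le> J (\<lambda>p. f p * g p)" "J (\<lambda>p. f p * g p) \<le> 1"
  using assms by (auto intro!: J.bounds mult_le_one simp: unit_valued_def)

lemma correlation_bounded:
  assumes g: "g \<in> carrier G"
  shows "\<bar>correlation g\<bar> \<le> 1"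
proof -
  have u: "unit_valued (e \<one> g)" using g by (simp add: unit_valued_e)
  have "0 \<le> correlation g" unfolding correlation_def
    using pairing_lim[OF u] J_unit[OF unit_valued_midpoints[OF near_min(1)] u] by (intro LIMSEQ_le_const) auto
  moreover have "correlation g \<le> 1" unfolding correlation_def
    using pairing_lim[OF u] J_unit[OF unit_valued_midpoints[OF near_min(1)] u] by (intro LIMSEQ_le_const2) auto
  ultimately show ?thesis by simp
qed

lemma correlation_pos_imp:
  assumes g: "g \<in> carrier G" and pos: "0 < correlation g"
  obtains h x y where "h \<in> carrier G" "x \<in> carrier G" "y \<in> carrier G"
    "\<alpha> (inv h \<otimes> x) \<noteq> 0" "\<alpha> x \<noteq> 0" "\<beta> (inv h \<otimes> y) \<noteq> 0" "\<beta> (inv g \<otimes> y) \<noteq> 0"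
proof -
  have u: "unit_valued (e \<one> g)" using g by (simp add: unit_valued_e)
  obtain n where n: "0 < J (\<lambda>p. near_min n p * e \<one> g p)"
    using pairing_lim[OF u] pos unfolding correlation_def by (meson LIMSEQ_le_const2 not_le)
  have "0 < J (\<lambda>p. f p * e \<one> g p) \<Longrightarrow> \<exists>h\<in>carrier G. 0 < J (\<lambda>p. e h h p * e \<one> g p)"
    if "f \<in> midpoints" for f
    using that
  proof (induction rule: midpoints.induct)
    case (mid f g')
    then have "0 < J (\<lambda>p. f p * e \<one> g p) \<or> 0 < J (\<lambda>p. g' p * e \<one> g p)"
      using J_mid[of f g' "e \<one> g"] unit_valued_bounded[OF u] by (auto simp: bounded_midpoints)
    then show ?case using mid by blast
  qed blast
  then obtain h where h: "h \<in> carrier G" "0 < J (\<lambda>p. e h h p * e \<one> g p)"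
    using n near_min(1) by blast
  have "bounded_on X (\<lambda>p. e h h p * e \<one> g p)"
    using h(1) g by (intro bounded_on_intros bounded_e) auto
  then obtain p where p: "p \<in> X" "0 < e h h p * e \<one> g p"
    using h(2) by (rule J.positive_imp_ex)
  then have "e h h p \<noteq> 0" "e \<one> g p \<noteq> 0" by auto
  then show ?thesis using that[of h "fst p" "snd p"] h(1) p(1) by (auto simp: e_def)
qed

text \<open>For \<open>f = e k k\<close> the pairing is \<open>\<theta> a * \<psi> g\<close> with both factors in \<open>[0, 1]\<close>, so it is enough to cut
  \<open>[0, 1]\<close> into intervals of length \<open>\<epsilon>\<close> and to group the \<open>g\<close> by the interval that contains \<open>\<psi> g\<close>.\<close>

lemma midpoints_oscillation:
  assumes "f \<in> midpoints" "\<epsilon> > 0"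
  shows "finite_oscillation \<epsilon> (carrier G) (carrier G) (\<lambda>a g. J (\<lambda>p. f p * e a g p))"
  using assms(1)
proof (induction rule: midpoints.induct)
  case (base k)
  define \<psi> where "\<psi> g = M (\<lambda>y. \<beta> (inv k \<otimes> y) * \<beta> (inv g \<otimes> y))" for g
  define \<theta> where "\<theta> a = L (\<lambda>x. \<alpha> (inv k \<otimes> x) * \<alpha> (inv a \<otimes> x))" for a
  have J_e: "J (\<lambda>p. e k k p * e a g p) = \<theta> a * \<psi> g" if "a \<in> carrier G" "g \<in> carrier G" for a g
  proof -
    have "(\<lambda>p. e k k p * e a g p) = (\<lambda>p. (\<alpha> (inv k \<otimes> fst p) * \<alpha> (inv a \<otimes> fst p)) *
        (\<beta> (inv k \<otimes> snd p) * \<beta> (inv g \<otimes> snd p)))"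
      by (simp add: e_def mult_ac fun_eq_iff)
    then show ?thesis unfolding \<psi>_def \<theta>_def
      using J_product[of "\<lambda>x. \<alpha> (inv k \<otimes> x) * \<alpha> (inv a \<otimes> x)" "\<lambda>y. \<beta> (inv k \<otimes> y) * \<beta> (inv g \<otimes> y)"]
        base that by (simp add: bounded_translates)
  qed
  have \<theta>: "0 \<le> \<theta> a" "\<theta> a \<le> 1" if "a \<in> carrier G" for a
    unfolding \<theta>_def using base that \<alpha> by (auto intro!: L.bounds mult_le_one)
  have \<psi>: "0 \<le> \<psi> g" "\<psi> g \<le> 1" if "g \<in> carrier G" for g
    unfolding \<psi>_def using base that \<beta> by (auto intro!: M.bounds mult_le_one)
  define cell where "cell i = {g \<in> carrier G. \<lfloor>\<psi> g / \<epsilon>\<rfloor> = i}" for i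
  show ?case
  proof (rule finite_oscillationI)
    show "finite (cell ` {0..\<lfloor>1 / \<epsilon>\<rfloor>})" by simp
    show "carrier G \<subseteq> \<Union>(cell ` {0..\<lfloor>1 / \<epsilon>\<rfloor>})"
      using \<psi> assms(2) by (auto simp: cell_def intro!: floor_mono divide_right_mono)
    fix P g h a
    assume "P \<in> cell ` {0..\<lfloor>1 / \<epsilon>\<rfloor>}" "g \<in> P \<inter> carrier G" "h \<in> P \<inter> carrier G" and a: "a \<in> carrier G"
    then obtain i where gh: "g \<in> cell i" "h \<in> cell i" by auto
    have "\<bar>\<psi> g / \<epsilon> - \<psi> h / \<epsilon>\<bar> \<le> 1" using gh unfolding cell_def by simp linarith
    then have "\<bar>\<psi> g - \<psi> h\<bar> \<le> \<epsilon>"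
      using assms(2) by (simp add: diff_divide_distrib[symmetric] divide_le_eq)
    moreover have "\<theta> a * \<bar>\<psi> g - \<psi> h\<bar> \<le> 1 * \<bar>\<psi> g - \<psi> h\<bar>"
      using \<theta>[OF a] by (intro mult_right_mono) auto
    moreover have "J (\<lambda>p. e k k p * e a g p) - J (\<lambda>p. e k k p * e a h p) = \<theta> a * (\<psi> g - \<psi> h)"
      using J_e[OF a, of g] J_e[OF a, of h] gh by (simp add: cell_def algebra_simps)
    ultimately show "\<bar>J (\<lambda>p. e k k p * e a g p) - J (\<lambda>p. e k k p * e a h p)\<bar> \<le> \<epsilon>"
      using \<theta>[OF a] by (simp add: abs_mult)
  qed
next
  case (mid f f')
  obtain \<P> where P: "finite \<P>" "carrier G \<subseteq> \<Union>\<P>"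
    "\<And>P g h a. P \<in> \<P> \<Longrightarrow> g \<in> P \<inter> carrier G \<Longrightarrow> h \<in> P \<inter> carrier G \<Longrightarrow> a \<in> carrier G \<Longrightarrow>
       \<bar>(J (\<lambda>p. f p * e a g p) + J (\<lambda>p. f' p * e a g p)) / 2
        - (J (\<lambda>p. f p * e a h p) + J (\<lambda>p. f' p * e a h p)) / 2\<bar> \<le> \<epsilon>"
    by (rule finite_oscillationE[OF finite_oscillation_midpoint[OF mid.IH]]) (rule that)
  have mid_eq: "J (\<lambda>p. (f p + f' p) / 2 * e a x p) = (J (\<lambda>p. f p * e a x p) + J (\<lambda>p. f' p * e a x p)) / 2"
    if "a \<in> carrier G" "x \<in> carrier G" for a x
    using mid.hyps that by (intro J_mid bounded_midpoints bounded_e)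
  show ?case
  proof (rule finite_oscillationI[OF P(1,2)])
    fix P g h a
    assume P': "P \<in> \<P>" and g: "g \<in> P \<inter> carrier G" and h: "h \<in> P \<inter> carrier G"
      and a: "a \<in> carrier G"
    show "\<bar>J (\<lambda>p. (f p + f' p) / 2 * e a g p) - J (\<lambda>p. (f p + f' p) / 2 * e a h p)\<bar> \<le> \<epsilon>"
      unfolding mid_eq[OF a IntD2[OF g]] mid_eq[OF a IntD2[OF h]] by (rule P(3)[OF P' g h a])
  qed
qed

text \<open>Invariance moves the translation by \<open>x\<close> from the variable \<open>g\<close> to the other slot,
  \<open>correlation (x g) = \<langle>T, e x\<inverse> g\<rangle>\<close>, and up to \<open>\<epsilon> / 4\<close> the vector \<open>T\<close> may be replaced by an
  element of the hull, uniformly in \<open>x\<close> and \<open>g\<close>.\<close>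

lemma correlation_almost_periodic:
  assumes \<epsilon>: "\<epsilon> > 0"
  shows "finite_oscillation \<epsilon> (carrier G) (carrier G) (\<lambda>x g. correlation (x \<otimes> g))"
proof -
  have "eventually (\<lambda>n. rad n < \<epsilon> / 8) sequentially"
    using rad(2) \<epsilon> by (intro order_tendstoD) auto
  then obtain n where n: "rad n < \<epsilon> / 8" by (auto simp: eventually_sequentially)
  have shifted: "correlation (x \<otimes> g) = pairing (e (inv x) g)" if "x \<in> carrier G" "g \<in> carrier G" for x g
    using pairing_shift[of x "inv x" g] that by (simp add: correlation_def)
  have near: "\<bar>J (\<lambda>p. near_min n p * e (inv x) g p) - correlation (x \<otimes> g)\<bar> \<le> \<epsilon> / 4"
    if "x \<in> carrier G" "g \<in> carrier G" for x g
    using pairing_near[OF unit_valued_e[of "inv x" g] near_min[of n]] rad(1)[of n] n that by (simp add: shifted)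
  have "0 < \<epsilon> / 2" using \<epsilon> by simp
  from midpoints_oscillation[OF near_min(1)[of n] this]
  obtain \<P> where P: "finite \<P>" "carrier G \<subseteq> \<Union>\<P>"
    "\<And>P g h a. P \<in> \<P> \<Longrightarrow> g \<in> P \<inter> carrier G \<Longrightarrow> h \<in> P \<inter> carrier G \<Longrightarrow> a \<in> carrier G \<Longrightarrow>
       \<bar>J (\<lambda>p. near_min n p * e a g p) - J (\<lambda>p. near_min n p * e a h p)\<bar> \<le> \<epsilon> / 2"
    by (rule finite_oscillationE) (rule that)
  have "\<bar>correlation (x \<otimes> g) - correlation (x \<otimes> h)\<bar> \<le> \<epsilon>"
    if "P \<in> \<P>" "g \<in> P \<inter> carrier G" "h \<in> P \<inter> carrier G" "x \<in> carrier G" for P g h x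
  proof -
    have "\<bar>J (\<lambda>p. near_min n p * e (inv x) g p) - J (\<lambda>p. near_min n p * e (inv x) h p)\<bar> \<le> \<epsilon> / 2"
      using P(3)[OF that(1-3)] that(4) by simp
    moreover have "\<bar>J (\<lambda>p. near_min n p * e (inv x) g p) - correlation (x \<otimes> g)\<bar> \<le> \<epsilon> / 4"
      "\<bar>J (\<lambda>p. near_min n p * e (inv x) h p) - correlation (x \<otimes> h)\<bar> \<le> \<epsilon> / 4"
      using near that by auto
    ultimately show ?thesis by linarith
  qed
  then show ?thesis by (rule finite_oscillationI[OF P(1,2)])
qed

end

section \<open>The isometry group of a compact metric space\<close>

definition isometry_group :: "'x::metric_space set \<Rightarrow> ('x \<Rightarrow> 'x) monoid" where
  "isometry_group X = (BijGroup X)\<lparr>carrier :=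
     {p \<in> Bij X. \<forall>x\<in>X. \<forall>y\<in>X. dist (p x) (p y) = dist x y}\<rparr>"

definition pointwise_topology :: "'x::metric_space set \<Rightarrow> ('x \<Rightarrow> 'x) topology" where
  "pointwise_topology X =
     subtopology (product_topology (\<lambda>_. top_of_set X) X) (carrier (isometry_group X))"

lemma isometry_groupD:
  assumes "p \<in> carrier (isometry_group X)"
  shows "p \<in> Bij X" "\<And>x. x \<in> X \<Longrightarrow> p x \<in> X"
    "\<And>x y. x \<in> X \<Longrightarrow> y \<in> X \<Longrightarrow> dist (p x) (p y) = dist x y"
  using assms Bij_imp_funcset by (fastforce simp: isometry_group_def)+

lemma isometry_group_mult:
  assumes "p \<in> carrier (isometry_group X)" "q \<in> carrier (isometry_group X)"
  shows "p \<otimes>\<^bsub>isometry_group X\<^esub> q = compose X p q"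
  using assms by (simp add: isometry_group_def BijGroup_def)

lemma subgroup_isometries:
  "subgroup (carrier (isometry_group X)) (BijGroup X)"
proof -
  interpret B: group "BijGroup X" by (rule group_BijGroup)
  show ?thesis
  proof (rule B.subgroupI)
    show "carrier (isometry_group X) \<subseteq> carrier (BijGroup X)"
      by (auto simp: isometry_group_def BijGroup_def)
    show "carrier (isometry_group X) \<noteq> {}"
      using id_Bij[of X] by (auto simp: isometry_group_def intro!: exI[of _ "\<lambda>x\<in>X. x"])
  next
    fix p assume p: "p \<in> carrier (isometry_group X)"
    note P = isometry_groupD[OF p]
    have inv: "inv\<^bsub>BijGroup X\<^esub> p = restrict (inv_into X p) X"
      by (rule inv_BijGroup[OF P(1)])
    have X: "p ` X = X" using P(1) by (simp add: Bij_def bij_betw_def)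
    have "dist (inv_into X p x) (inv_into X p y) = dist x y" if "x \<in> X" "y \<in> X" for x y
      using P(3)[of "inv_into X p x" "inv_into X p y"] that X
      by (simp add: inv_into_into f_inv_into_f)
    then show "inv\<^bsub>BijGroup X\<^esub> p \<in> carrier (isometry_group X)"
      unfolding inv using restrict_inv_into_Bij[OF P(1)] by (simp add: isometry_group_def)
  next
    fix p q assume p: "p \<in> carrier (isometry_group X)" and q: "q \<in> carrier (isometry_group X)"
    note P = isometry_groupD[OF p] and Q = isometry_groupD[OF q]
    show "p \<otimes>\<^bsub>BijGroup X\<^esub> q \<in> carrier (isometry_group X)"
      using P Q compose_Bij[OF P(1) Q(1)]
      by (simp add: BijGroup_def isometry_group_def compose_def)
  qed
qed

lemma group_isometry_group: "group (isometry_group X)"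
  using subgroup.subgroup_is_group[OF subgroup_isometries group_BijGroup, of X]
  by (simp add: isometry_group_def)

lemma isometry_group_inv:
  assumes "p \<in> carrier (isometry_group X)"
  shows "inv\<^bsub>isometry_group X\<^esub> p = restrict (inv_into X p) X"
  using group.m_inv_consistent[OF group_BijGroup subgroup_isometries assms]
    inv_BijGroup[OF isometry_groupD(1)[OF assms]]
  by (simp add: isometry_group_def)

lemma topspace_pointwise_topology:
  "topspace (pointwise_topology X) = carrier (isometry_group X)"
  by (auto simp: pointwise_topology_def isometry_group_def Bij_def bij_betw_def PiE_iff extensional_def)

lemma continuous_map_evaluation:
  assumes "x \<in> X"
  shows "continuous_map (pointwise_topology X) euclidean (\<lambda>p. p x)"
proof -
  have "continuous_map (product_topology (\<lambda>_. top_of_set X) X) (top_of_set X) (\<lambda>p. p x)"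
    by (rule continuous_map_product_projection[OF assms])
  then show ?thesis
    unfolding pointwise_topology_def
    by (simp add: continuous_map_in_subtopology continuous_map_from_subtopology)
qed

lemma openin_pointwise_nhd:
  assumes "x \<in> X"
  shows "openin (pointwise_topology X) {p \<in> carrier (isometry_group X). dist (p x) a < \<epsilon>}"
proof -
  have "{p \<in> carrier (isometry_group X). dist (p x) a < \<epsilon>}
      = {p \<in> topspace (pointwise_topology X). p x \<in> ball a \<epsilon>}"
    by (auto simp: topspace_pointwise_topology dist_commute)
  then show ?thesis
    using openin_continuous_map_preimage[OF continuous_map_evaluation[OF assms], of "ball a \<epsilon>"]
    by simp
qed

lemma continuous_map_into_pointwise:
  assumes "f \<in> topspace Z \<rightarrow> carrier (isometry_group X)"
    and "\<And>x z \<epsilon>. x \<in> X \<Longrightarrow> z \<in> topspace Z \<Longrightarrow> \<epsilon> > 0 \<Longrightarrow>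
           \<exists>U. openin Z U \<and> z \<in> U \<and> (\<forall>y\<in>U. dist (f y x) (f z x) < \<epsilon>)"
  shows "continuous_map Z (pointwise_topology X) f"
proof -
  have "continuous_map Z (top_of_set X) (\<lambda>z. f z x)" if x: "x \<in> X" for x
  proof -
    have "continuous_map Z Met_TC.mtopology (\<lambda>z. f z x)"
      unfolding Met_TC.continuous_map_to_metric
      using assms(2)[OF x] by (auto simp: dist_commute)
    moreover have "(\<lambda>z. f z x) \<in> topspace Z \<rightarrow> X"
      using assms(1) isometry_groupD(2)[OF _ x] by (simp add: Pi_iff)
    ultimately show ?thesis
      by (simp add: continuous_map_in_subtopology)
  qed
  moreover have "f ` topspace Z \<subseteq> extensional X"
    using assms(1) isometry_groupD(1) Bij_imp_extensional by fast
  ultimately show ?thesis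
    using assms(1)
    by (auto simp: pointwise_topology_def continuous_map_in_subtopology continuous_map_componentwise)
qed

text \<open>If \<open>y\<close> had distance \<open>r > 0\<close> from \<open>f ` X\<close>, then the orbit \<open>y, f y, f (f y), ...\<close> would be
  \<open>r\<close>-separated, which is impossible in a compact set.\<close>

lemma isometry_compact_surj:
  fixes X :: "'x::metric_space set"
  assumes X: "compact X" and f: "f \<in> X \<rightarrow> X"
    and iso: "\<And>x y. x \<in> X \<Longrightarrow> y \<in> X \<Longrightarrow> dist (f x) (f y) = dist x y"
  shows "f ` X = X"
proof (rule ccontr)
  assume "f ` X \<noteq> X"
  then obtain y where y: "y \<in> X" "y \<notin> f ` X" using f by auto
  have "continuous_on X f"
    by (rule continuous_onI) (use iso in force)
  then have "compact (f ` X)" using X compact_continuous_image by blast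
  then have "open (- (f ` X))" by (simp add: compact_imp_closed open_Compl)
  then obtain r where r: "r > 0" "ball y r \<subseteq> - (f ` X)" using y by (meson ComplI openE)
  have far: "r \<le> dist y (f x)" if "x \<in> X" for x
    using r(2) that by (meson ComplD image_eqI in_mono mem_ball not_le)
  have mem: "(f ^^ n) y \<in> X" for n using y(1) f by (induction n) auto
  have iter: "dist ((f ^^ n) u) ((f ^^ n) v) = dist u v" if "u \<in> X" "v \<in> X" for n u v
  proof -
    have "(f ^^ n) u \<in> X \<and> (f ^^ n) v \<in> X \<and> dist ((f ^^ n) u) ((f ^^ n) v) = dist u v"
      using that f iso by (induction n) auto
    then show ?thesis by simp
  qed
  have sep: "r \<le> dist ((f ^^ n) y) ((f ^^ m) y)" if nm: "n < m" for n m
  proof -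
    obtain k where "m = Suc (n + k)" using less_imp_Suc_add[OF nm] by blast
    then have k: "m = n + Suc k" by simp
    have "(f ^^ m) y = (f ^^ n) ((f ^^ Suc k) y)"
      by (simp only: k funpow_add o_apply)
    then have "dist ((f ^^ n) y) ((f ^^ m) y) = dist y (f ((f ^^ k) y))"
      using iter[OF y(1) mem[of "Suc k"], of n] by simp
    then show ?thesis using far[OF mem[of k]] by simp
  qed
  obtain l s where s: "strict_mono (s :: nat \<Rightarrow> nat)" "((\<lambda>n. (f ^^ n) y) \<circ> s) \<longlonglongrightarrow> l"
    using X mem unfolding compact_def by metis
  then have "Cauchy ((\<lambda>n. (f ^^ n) y) \<circ> s)" using LIMSEQ_imp_Cauchy by blast
  then obtain N where "\<forall>m\<ge>N. \<forall>n\<ge>N. dist ((f ^^ (s m)) y) ((f ^^ (s n)) y) < r"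
    using r(1) unfolding Cauchy_def by auto
  then have "dist ((f ^^ (s N)) y) ((f ^^ (s (Suc N))) y) < r" by simp
  moreover have "s N < s (Suc N)" using s(1) by (simp add: strict_mono_def)
  ultimately show False using sep[of "s N" "s (Suc N)"] by simp
qed

text \<open>The isometries are closed in the compact product \<open>X\<^sup>X\<close>: preservation of distances is a closed
  condition, and surjectivity follows from it.\<close>

lemma compact_space_pointwise_topology:
  assumes X: "compact X"
  shows "compact_space (pointwise_topology X)"
proof -
  let ?P = "product_topology (\<lambda>_. top_of_set X) X"
  have P: "compact_space ?P"
    using X by (simp add: compact_space_product_topology compact_space_subtopology)
  have "carrier (isometry_group X) = 
     \<Inter>(insert (topspace ?P)
       ((\<lambda>(x, y). {p \<in> topspace ?P. dist (p x) (p y) = dist x y}) ` (X \<times> X)))" (is "?L = ?R")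
  proof
    show "?L \<subseteq> ?R"
      by (auto simp: isometry_group_def Bij_def bij_betw_def PiE_iff extensional_def)
    show "?R \<subseteq> ?L"
    proof
      fix p assume p: "p \<in> ?R"
      then have pX: "p \<in> X \<rightarrow> X" "p \<in> extensional X" by (auto simp: PiE_iff)
      have iso: "dist (p x) (p y) = dist x y" if "x \<in> X" "y \<in> X" for x y
        using p that by fastforce
      have "inj_on p X"
        by (rule inj_onI) (metis iso dist_eq_0_iff)
      then show "p \<in> ?L"
        using pX iso isometry_compact_surj[OF X pX(1) iso]
        by (simp add: isometry_group_def Bij_def bij_betw_def)
    qed
  qed
  moreover have "closedin ?P {p \<in> topspace ?P. dist (p x) (p y) = dist x y}"
    if "x \<in> X" "y \<in> X" for x y
  proof -
    have pr: "continuous_map ?P euclidean (\<lambda>p. p z)" if "z \<in> X" for z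
      using continuous_map_product_projection[OF that, of "\<lambda>_. top_of_set X"]
      by (simp add: continuous_map_in_subtopology)
    have "continuous_map ?P (prod_topology euclidean euclidean) (\<lambda>p. (p x, p y))"
      using pr that by (intro continuous_map_pairedI)
    then have "continuous_map ?P euclidean ((\<lambda>(a, b). dist a b) \<circ> (\<lambda>p. (p x, p y)))"
      by (rule continuous_map_compose)
        (auto simp: case_prod_unfold intro!: continuous_intros)
    then show ?thesis
      using closedin_continuous_map_preimage[of ?P euclidean _ "{dist x y}"]
      by (fastforce simp: o_def)
  qed
  then have "closedin ?P (\<Inter>(insert (topspace ?P)
       ((\<lambda>(x, y). {p \<in> topspace ?P. dist (p x) (p y) = dist x y}) ` (X \<times> X))))"
    by (intro closedin_Inter) (auto simp del: topspace_product_topology)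
  ultimately have "closedin ?P (carrier (isometry_group X))"
    by (simp only:)
  then show ?thesis
    unfolding pointwise_topology_def
    by (intro compact_space_subtopology closedin_compact_space[OF P])
qed

text \<open>For isometries pointwise convergence suffices for continuity of the operations, since
  \<open>d (p' (q' x), p (q x)) \<le> d (q' x, q x) + d (p' (q x), p (q x))\<close> and, with \<open>w = p\<inverse> x\<close>,
  \<open>d (q\<inverse> x, p\<inverse> x) = d (x, q w)\<close>.\<close>

theorem compact_Hausdorff_isometry_group:
  assumes X: "compact X"
  shows "compact_Hausdorff_group (isometry_group X) (pointwise_topology X)"
proof -
  let ?K = "isometry_group X" and ?T = "pointwise_topology X"
  interpret K: group ?K by (rule group_isometry_group)
  note ts = topspace_pointwise_topology[of X]
  have "continuous_map (prod_topology ?T ?T) ?T (\<lambda>(p, q). p \<otimes>\<^bsub>?K\<^esub> q)"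
  proof (rule continuous_map_into_pointwise)
    fix x z and \<epsilon> :: real
    assume x: "x \<in> X" and z: "z \<in> topspace (prod_topology ?T ?T)" and \<epsilon>: "\<epsilon> > 0"
    obtain p q where pq: "z = (p, q)" "p \<in> carrier ?K" "q \<in> carrier ?K"
      using z by (auto simp: ts)
    define \<delta> where "\<delta> = \<epsilon> / 2"
    have \<delta>: "\<delta> > 0" "\<epsilon> = \<delta> + \<delta>" using \<epsilon> by (simp_all add: \<delta>_def)
    let ?U = "{p' \<in> carrier ?K. dist (p' (q x)) (p (q x)) < \<delta>}"
    let ?V = "{q' \<in> carrier ?K. dist (q' x) (q x) < \<delta>}"
    have qx: "q x \<in> X" using isometry_groupD(2)[OF pq(3) x] .
    have "dist (p' (q' x)) (p (q x)) < \<epsilon>" if "p' \<in> ?U" "q' \<in> ?V" for p' q'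
    proof -
      have "dist (p' (q' x)) (p' (q x)) = dist (q' x) (q x)"
        using that isometry_groupD(2,3) x qx by blast
      then show ?thesis
        using that dist_triangle[of "p' (q' x)" "p (q x)" "p' (q x)"] \<delta>(2) by auto
    qed
    then show "\<exists>U. openin (prod_topology ?T ?T) U \<and> z \<in> U \<and>
        (\<forall>y\<in>U. dist ((case y of (p, q) \<Rightarrow> p \<otimes>\<^bsub>?K\<^esub> q) x) ((case z of (p, q) \<Rightarrow> p \<otimes>\<^bsub>?K\<^esub> q) x) < \<epsilon>)"
      using x qx pq \<delta>(1) openin_pointwise_nhd[OF x] openin_pointwise_nhd[OF qx]
      by (intro exI[of _ "?U \<times> ?V"])
        (auto simp: openin_prod_Times_iff isometry_group_mult compose_eq)
  qed (auto simp: ts)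
  moreover have "continuous_map ?T ?T (\<lambda>p. inv\<^bsub>?K\<^esub> p)"
  proof (rule continuous_map_into_pointwise)
    fix x p and \<epsilon> :: real
    assume x: "x \<in> X" and "p \<in> topspace ?T" and \<epsilon>: "\<epsilon> > 0"
    then have p: "p \<in> carrier ?K" by (simp add: ts)
    define w where "w = inv_into X p x"
    have im: "q ` X = X" if "q \<in> carrier ?K" for q
      using isometry_groupD(1)[OF that] by (simp add: Bij_def bij_betw_def)
    have w: "w \<in> X" "p w = x" using im[OF p] x by (auto simp: w_def inv_into_into f_inv_into_f)
    let ?U = "{q \<in> carrier ?K. dist (q w) x < \<epsilon>}"
    have "dist ((inv\<^bsub>?K\<^esub> q) x) ((inv\<^bsub>?K\<^esub> p) x) < \<epsilon>" if q: "q \<in> ?U" for q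
    proof -
      have qK: "q \<in> carrier ?K" using q by simp
      have "inv_into X q x \<in> X" "q (inv_into X q x) = x"
        using im[OF qK] x by (auto simp: inv_into_into f_inv_into_f)
      then have "dist (inv_into X q x) w = dist x (q w)"
        using isometry_groupD(3)[OF qK _ w(1)] by metis
      then show ?thesis
        using q x by (simp add: isometry_group_inv[OF qK] isometry_group_inv[OF p]
            w_def[symmetric] dist_commute)
    qed
    then show "\<exists>U. openin ?T U \<and> p \<in> U \<and> (\<forall>q\<in>U. dist ((inv\<^bsub>?K\<^esub> q) x) ((inv\<^bsub>?K\<^esub> p) x) < \<epsilon>)"
      using w p \<epsilon> openin_pointwise_nhd[OF w(1)] by (intro exI[of _ ?U]) auto
  qed (auto simp: ts)
  moreover have "Hausdorff_space ?T"
    unfolding pointwise_topology_def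
    by (intro Hausdorff_space_subtopology)
      (simp add: Hausdorff_space_product_topology Hausdorff_space_subtopology)
  ultimately show ?thesis
    unfolding compact_Hausdorff_group_def topological_group_def
    using group_isometry_group compact_space_pointwise_topology[OF X] ts by blast
qed

text \<open>The action is a homomorphism to a compact Hausdorff group, so it extends continuously to the
  Bohr compactification; evaluation at \<open>x\<close> is continuous.\<close>

lemma openin_bohr_orbit:
  assumes G: "group G" and b: "bohr_compactification G bG bT \<eta>"
    and X: "compact X" and act: "act \<in> hom G (isometry_group X)"
    and x: "x \<in> X" and V: "open V"
  shows "openin (bohr_topology G bT \<eta>) {g \<in> carrier G. act g x \<in> V}"
proof -
  obtain h where h: "continuous_map bT (pointwise_topology X) h" "\<forall>g\<in>carrier G. act g = h (\<eta> g)"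
    using bohr_compactification_universal[OF G b compact_Hausdorff_isometry_group[OF X] act]
    by (auto simp: continuous_homs_def)
  have "continuous_map (bohr_topology G bT \<eta>) euclidean ((\<lambda>p. p x) \<circ> (h \<circ> \<eta>))"
    by (intro continuous_map_compose[OF _ continuous_map_evaluation[OF x]]
        continuous_map_compose[OF _ h(1)] bohr_topology_smallest(2)[OF b])
  from openin_continuous_map_preimage[OF this, of V]
  have "openin (bohr_topology G bT \<eta>)
      {g \<in> topspace (bohr_topology G bT \<eta>). ((\<lambda>p. p x) \<circ> (h \<circ> \<eta>)) g \<in> V}"
    using V by simp
  moreover have "{g \<in> topspace (bohr_topology G bT \<eta>). ((\<lambda>p. p x) \<circ> (h \<circ> \<eta>)) g \<in> V}
      = {g \<in> carrier G. act g x \<in> V}"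
    using h(2) by (auto simp: bohr_topology_smallest(1)[OF b])
  ultimately show ?thesis by simp
qed

section \<open>Almost periodic functions and the Bohr topology\<close>

text \<open>The bounded functions on \<open>G\<close> are taken as continuous functions on the discrete copy of the type,
  which supplies completeness. The group acts on them by \<open>(y \<cdot> \<phi>) x = \<phi> (x y)\<close>, isometrically, and
  by assumption the orbit of \<open>c\<close> has compact closure. The set \<open>c > 0\<close> is where the moved function
  \<open>g \<cdot> c\<close> is positive at 1.\<close>

lemma openin_bohr_almost_periodic:
  fixes G :: "('a, 'm) monoid_scheme" and c :: "'a \<Rightarrow> real"
  assumes G: "group G" and b: "bohr_compactification G bG bT \<eta>"
    and bound: "\<And>g. g \<in> carrier G \<Longrightarrow> \<bar>c g\<bar> \<le> B"
    and tb: "\<And>\<epsilon>. \<epsilon> > 0 \<Longrightarrow> finite_oscillation \<epsilon> (carrier G) (carrier G) (\<lambda>x g. c (x \<otimes>\<^bsub>G\<^esub> g))"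
  shows "openin (bohr_topology G bT \<eta>) {g \<in> carrier G. c g > 0}"
proof -
  interpret group G by (rule G)
  \<comment> \<open>Fixing the points outside the carrier makes the translations act on all functions on the type, and there by isometries.\<close>
  define \<pi> where "\<pi> y x = (if x \<in> carrier G then x \<otimes>\<^bsub>G\<^esub> y else x)" for y x
  define shift :: "'a \<Rightarrow> ('a discrete \<Rightarrow>\<^sub>C real) \<Rightarrow> ('a discrete \<Rightarrow>\<^sub>C real)" where
    "shift y \<phi> = Bcontfun (\<lambda>z. apply_bcontfun \<phi> (discrete (\<pi> y (of_discrete z))))" for y \<phi>
  have cont: "continuous_on UNIV f" for f :: "'a discrete \<Rightarrow> real"
    by (simp add: continuous_on_open_vimage open_discrete)
  have shift: "apply_bcontfun (shift y \<phi>) z = apply_bcontfun \<phi> (discrete (\<pi> y (of_discrete z)))" for y \<phi> z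
  proof -
    have "bounded (range (apply_bcontfun \<phi>))" using apply_bcontfun[of \<phi>] by (simp add: bcontfun_def)
    then have "bounded (range (\<lambda>z. apply_bcontfun \<phi> (discrete (\<pi> y (of_discrete z)))))"
      by (rule bounded_subset) auto
    then show ?thesis
      unfolding shift_def by (subst Bcontfun_inverse) (simp_all add: bcontfun_def cont)
  qed
  define \<phi> :: "'a discrete \<Rightarrow>\<^sub>C real" where
    "\<phi> = Bcontfun (\<lambda>z. if of_discrete z \<in> carrier G then c (of_discrete z) else 0)"
  have \<phi>: "apply_bcontfun \<phi> z = (if of_discrete z \<in> carrier G then c (of_discrete z) else 0)" for z
    unfolding \<phi>_def
  proof (subst Bcontfun_inverse)
    show "(\<lambda>z. if of_discrete z \<in> carrier G then c (of_discrete z) else 0) \<in> bcontfun"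
      by (rule bcontfun_normI[of _ "\<bar>B\<bar>"]) (use bound cont in fastforce)+
  qed simp
  have of_d: "of_discrete (discrete x) = x" for x :: 'a by (simp add: discrete_inverse)
  have shift_mult: "shift y (shift h \<psi>) = shift (y \<otimes>\<^bsub>G\<^esub> h) \<psi>"
    if "y \<in> carrier G" "h \<in> carrier G" for y h \<psi>
    by (rule bcontfun_eqI) (use that in \<open>auto simp: shift \<pi>_def of_d m_assoc\<close>)
  have shift_one: "shift \<one>\<^bsub>G\<^esub> \<psi> = \<psi>" for \<psi>
    by (rule bcontfun_eqI) (auto simp: shift \<pi>_def of_discrete_inverse)
  have shift_le: "dist (shift y \<psi>) (shift y \<psi>') \<le> dist \<psi> \<psi>'" for y \<psi> \<psi>'
    by (rule dist_bound) (simp add: shift dist_bounded)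
  have shift_inv: "shift (inv\<^bsub>G\<^esub> y) (shift y \<psi>) = \<psi>" "shift y (shift (inv\<^bsub>G\<^esub> y) \<psi>) = \<psi>"
    if "y \<in> carrier G" for y \<psi>
    using that by (simp_all add: shift_mult shift_one)
  have shift_dist: "dist (shift y \<psi>) (shift y \<psi>') = dist \<psi> \<psi>'" if "y \<in> carrier G" for y \<psi> \<psi>'
    using shift_le[of y \<psi> \<psi>'] shift_le[of "inv\<^bsub>G\<^esub> y" "shift y \<psi>" "shift y \<psi>'"] that
    by (simp add: shift_inv)
  define Orb where "Orb = (\<lambda>g. shift g \<phi>) ` carrier G"
  define X where "X = closure Orb"
  have shift_X: "shift y ` X \<subseteq> X" if y: "y \<in> carrier G" for y
    unfolding X_def
  proof (rule image_closure_subset)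
    show "continuous_on (closure Orb) (shift y)"
      by (rule continuous_onI) (use shift_dist[OF y] in force)
    show "shift y ` Orb \<subseteq> closure Orb"
      using y closure_subset[of Orb] by (auto simp: Orb_def shift_mult)
  qed simp
  have X: "compact X"
    unfolding compact_eq_totally_bounded
  proof (intro conjI allI impI)
    show "complete X" by (simp add: X_def complete_eq_closed)
    fix e :: real assume e: "e > 0"
    then have "0 < e / 2" by simp
    from tb[OF this] obtain \<P> where P: "finite \<P>" "carrier G \<subseteq> \<Union>\<P>"
      and close: "\<And>P g h x. P \<in> \<P> \<Longrightarrow> g \<in> P \<inter> carrier G \<Longrightarrow> h \<in> P \<inter> carrier G \<Longrightarrow> x \<in> carrier G \<Longrightarrow>
           \<bar>c (x \<otimes>\<^bsub>G\<^esub> g) - c (x \<otimes>\<^bsub>G\<^esub> h)\<bar> \<le> e / 2"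
      by (rule finite_oscillationE) (rule that)
    define r where "r P = (SOME g. g \<in> P \<inter> carrier G)" for P
    let ?k = "(\<lambda>P. shift (r P) \<phi>) ` \<P>"
    have "Orb \<subseteq> (\<Union>\<psi>\<in>?k. cball \<psi> (e / 2))"
    proof
      fix \<psi> assume "\<psi> \<in> Orb"
      then obtain g where g: "g \<in> carrier G" "\<psi> = shift g \<phi>" by (auto simp: Orb_def)
      then obtain p where p: "p \<in> \<P>" "g \<in> p \<inter> carrier G" using P by auto
      then have r: "r p \<in> p \<inter> carrier G" unfolding r_def by (metis someI)
      have "dist (shift (r p) \<phi>) \<psi> \<le> e / 2"
        by (rule dist_bound)
          (use close[OF p(1) r p(2)] e in \<open>auto simp: g(2) shift \<phi> \<pi>_def of_d dist_real_def
             m_closed[OF _ g(1)] m_closed[OF _ IntD2[OF r]]\<close>)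
      then show "\<psi> \<in> (\<Union>\<psi>\<in>?k. cball \<psi> (e / 2))" using p(1) by auto
    qed
    moreover have "closed (\<Union>\<psi>\<in>?k. cball \<psi> (e / 2))" using P(1) by auto
    ultimately have "X \<subseteq> (\<Union>\<psi>\<in>?k. cball \<psi> (e / 2))"
      unfolding X_def by (rule closure_minimal)
    also have "\<dots> \<subseteq> (\<Union>\<psi>\<in>?k. ball \<psi> e)" using e by (intro UN_mono) auto
    finally show "\<exists>k. finite k \<and> X \<subseteq> (\<Union>\<psi>\<in>k. ball \<psi> e)" using P(1) by blast
  qed
  define act where "act y = restrict (shift y) X" for y
  have act_iso: "act y \<in> carrier (isometry_group X)" if y: "y \<in> carrier G" for y
  proof -
    have "bij_betw (shift y) X X"
      by (rule bij_betw_byWitness[where f' = "shift (inv\<^bsub>G\<^esub> y)"])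
        (use y shift_X in \<open>auto simp: shift_inv\<close>)
    then show ?thesis
      using shift_dist[OF y] by (simp add: isometry_group_def Bij_def act_def)
  qed
  have "act \<in> hom G (isometry_group X)"
  proof (rule homI)
    fix y h assume yh: "y \<in> carrier G" "h \<in> carrier G"
    have "act (y \<otimes>\<^bsub>G\<^esub> h) = compose X (act y) (act h)"
      using shift_X[OF yh(2)] yh by (auto simp: act_def compose_def shift_mult fun_eq_iff)
    then show "act (y \<otimes>\<^bsub>G\<^esub> h) = act y \<otimes>\<^bsub>isometry_group X\<^esub> act h"
      using act_iso yh by (simp add: isometry_group_mult)
  qed (rule act_iso)
  moreover have \<phi>X: "\<phi> \<in> X"
    using closure_subset[of Orb] shift_one[of \<phi>] by (force simp: X_def Orb_def)
  moreover have "open {\<psi> :: 'a discrete \<Rightarrow>\<^sub>C real. 0 < apply_bcontfun \<psi> (discrete \<one>\<^bsub>G\<^esub>)}"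
  proof (rule open_Collect_less)
    show "continuous_on UNIV (\<lambda>\<psi> :: 'a discrete \<Rightarrow>\<^sub>C real. apply_bcontfun \<psi> (discrete \<one>\<^bsub>G\<^esub>))"
    proof (rule continuous_onI)
      fix \<psi> :: "'a discrete \<Rightarrow>\<^sub>C real" and e :: real assume "e > 0"
      then show "\<exists>d>0. \<forall>\<psi>'\<in>UNIV. dist \<psi>' \<psi> < d \<longrightarrow>
          dist (apply_bcontfun \<psi>' (discrete \<one>\<^bsub>G\<^esub>)) (apply_bcontfun \<psi> (discrete \<one>\<^bsub>G\<^esub>)) \<le> e"
        by (meson dist_bounded less_imp_le order_trans)
    qed
  qed simp
  ultimately have "openin (bohr_topology G bT \<eta>)
      {g \<in> carrier G. act g \<phi> \<in> {\<psi>. 0 < apply_bcontfun \<psi> (discrete \<one>\<^bsub>G\<^esub>)}}"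
    by (intro openin_bohr_orbit[OF G b X])
  also have "{g \<in> carrier G. act g \<phi> \<in> {\<psi>. 0 < apply_bcontfun \<psi> (discrete \<one>\<^bsub>G\<^esub>)}}
      = {g \<in> carrier G. c g > 0}"
    using \<phi>X by (auto simp: act_def shift \<phi> \<pi>_def of_d)
  finally show ?thesis .
qed

theorem corollary15p7:
  fixes G :: "('a, 'm) monoid_scheme" and bG :: "('b, 'n) monoid_scheme"
    and bT :: "'b topology" and \<eta> :: "'a \<Rightarrow> 'b" and A B :: "'a set"
  assumes "amenable_group G"
    and "bohr_compactification G bG bT \<eta>"
    and "A \<subseteq> carrier G" and "B \<subseteq> carrier G"
    and "sigma_R G A > 0" and "sigma_R G B > 0"
  shows "\<exists>U. openin (bohr_topology G bT \<eta>) U \<and> \<one>\<^bsub>G\<^esub> \<in> U \<and>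
             U \<subseteq> A <#>\<^bsub>G\<^esub> (set_inv\<^bsub>G\<^esub> A) <#>\<^bsub>G\<^esub> B <#>\<^bsub>G\<^esub> (set_inv\<^bsub>G\<^esub> B)"
proof -
  have "group G" using assms(1) by (simp add: amenable_group_def)
  then interpret group G .
  obtain L where L: "mean (carrier G) L" "0 < L (indicator A)"
    "\<And>k f. k \<in> carrier G \<Longrightarrow> bounded_on (carrier G) f \<Longrightarrow> L (\<lambda>x. f (k \<otimes>\<^bsub>G\<^esub> x)) = L f"
    using invariant_mean_positive[OF assms(1,3,5)] by metis
  obtain M where M: "mean (carrier G) M" "0 < M (indicator B)"
    "\<And>k f. k \<in> carrier G \<Longrightarrow> bounded_on (carrier G) f \<Longrightarrow> M (\<lambda>x. f (k \<otimes>\<^bsub>G\<^esub> x)) = M f"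
    using invariant_mean_positive[OF assms(1,4,6)] by metis
  interpret L: mean "carrier G" L by (rule L(1))
  interpret M: mean "carrier G" M by (rule M(1))
  interpret P: mean_pair G L M "indicator A" "indicator B"
    by unfold_locales (use L M in \<open>auto simp: indicator_def\<close>)
  let ?U = "{g \<in> carrier G. P.correlation g > 0}"
  have "openin (bohr_topology G bT \<eta>) ?U"
    by (rule openin_bohr_almost_periodic[OF is_group assms(2) P.correlation_bounded P.correlation_almost_periodic])
  moreover have "\<one>\<^bsub>G\<^esub> \<in> ?U" using P.correlation_one_pos by simp
  moreover have "?U \<subseteq> A <#>\<^bsub>G\<^esub> (set_inv\<^bsub>G\<^esub> A) <#>\<^bsub>G\<^esub> B <#>\<^bsub>G\<^esub> (set_inv\<^bsub>G\<^esub> B)"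
  proof
    fix g assume "g \<in> ?U"
    then have g: "g \<in> carrier G" "P.correlation g > 0" by auto
    obtain h x y where hxy: "h \<in> carrier G" "x \<in> carrier G" "y \<in> carrier G"
      and mem: "inv\<^bsub>G\<^esub> h \<otimes>\<^bsub>G\<^esub> x \<in> A" "x \<in> A" "inv\<^bsub>G\<^esub> h \<otimes>\<^bsub>G\<^esub> y \<in> B" "inv\<^bsub>G\<^esub> g \<otimes>\<^bsub>G\<^esub> y \<in> B"
      using P.correlation_pos_imp[OF g] by (auto simp: indicator_def split: if_splits)
    have h: "h = x \<otimes>\<^bsub>G\<^esub> inv\<^bsub>G\<^esub> (inv\<^bsub>G\<^esub> h \<otimes>\<^bsub>G\<^esub> x)"
      using hxy by (simp add: inv_mult_group m_assoc[symmetric])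
    have gh: "g = h \<otimes>\<^bsub>G\<^esub> (inv\<^bsub>G\<^esub> h \<otimes>\<^bsub>G\<^esub> y) \<otimes>\<^bsub>G\<^esub> inv\<^bsub>G\<^esub> (inv\<^bsub>G\<^esub> g \<otimes>\<^bsub>G\<^esub> y)"
      using hxy g by (simp add: inv_mult_group m_assoc[symmetric])
    have "h \<in> A <#>\<^bsub>G\<^esub> set_inv\<^bsub>G\<^esub> A"
      by (subst h) (use mem in \<open>auto simp: set_mult_def SET_INV_def\<close>)
    then show "g \<in> A <#>\<^bsub>G\<^esub> (set_inv\<^bsub>G\<^esub> A) <#>\<^bsub>G\<^esub> B <#>\<^bsub>G\<^esub> (set_inv\<^bsub>G\<^esub> B)"
      by (subst gh) (use mem in \<open>auto simp: set_mult_def SET_INV_def\<close>)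
  qed
  ultimately show ?thesis by blast
qed

end
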